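(* There is no regular dihedral $\mathrm{ETF}(36,18)$.
   Context: $D_n$ is generated by $\mu,\tau$ with $\mu^n=\tau^2=1$, $\tau\mu=\mu^{-1}\tau$. A dihedral configuration is $(\pi(g)v)_{g\in D_n}$ for a unit vector $v\in\mathbb{C}^n$ and a projective unitary representation $\pi:D_n\to U(n)$ ($\pi(gg')$ equals $\pi(g)\pi(g')$ up to a unimodular scalar), strict or not; it is regular if $v,\pi(\mu)v,\dots,\pi(\mu^{n-1})v$ form a basis of $\mathbb{C}^n$. An $\mathrm{ETF}(36,18)$ is a family of $36$ unit vectors in $\mathbb{C}^{18}$ forming a tight frame with $|\langle\varphi_i,\varphi_j\rangle|$ constant for $i\ne j$; here $n=18$. *)

theory Defs
  imports "Jordan_Normal_Form.Schur_Decomposition"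
begin

text \<open>
  The dihedral group of order \<open>2 * n\<close>, for \<open>n > 0\<close>.  The pair \<open>(a, s)\<close> encodes
  \<open>\<mu> ^ a * \<tau> ^ s\<close>, with \<open>s\<close> read as the exponent 0 or 1, where \<open>\<mu>\<close> is
  \<open>rotation n\<close> and \<open>\<tau>\<close> is \<open>reflection\<close>; the multiplication is the one forced
  by \<open>\<tau> * \<mu> = \<mu>\<^sup>-\<^sup>1 * \<tau>\<close>.
\<close>

definition dihedral :: "nat \<Rightarrow> (int \<times> bool) monoid" where
  "dihedral n =
    \<lparr>carrier = {0..<int n} \<times> UNIV,
     monoid.mult = (\<lambda>(a, s) (b, t). ((a + (if s then - b else b)) mod int n, s \<noteq> t)),
     monoid.one = (0, False)\<rparr>"

definition rotation :: "nat \<Rightarrow> int \<times> bool"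
  where "rotation n = (1 mod int n, False)"

definition reflection :: "int \<times> bool"
  where "reflection = (0, True)"

lemma dihedral_group:
  assumes "n > 0"
  shows "group (dihedral n)"
proof (rule groupI)
  fix x assume "x \<in> carrier (dihedral n)"
  then obtain a s where x: "x = (a, s)" "0 \<le> a" "a < int n"
    by (auto simp: dihedral_def)
  let ?y = "((if s then a else - a) mod int n, s)"
  have "?y \<in> carrier (dihedral n)" "?y \<otimes>\<^bsub>dihedral n\<^esub> x = \<one>\<^bsub>dihedral n\<^esub>"
    using x assms by (auto simp: dihedral_def mod_simps)
  then show "\<exists>y\<in>carrier (dihedral n). y \<otimes>\<^bsub>dihedral n\<^esub> x = \<one>\<^bsub>dihedral n\<^esub>" by blast
qed (use assms in \<open>auto simp: dihedral_def mod_simps algebra_simps\<close>)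

lemma card_dihedral: "card (carrier (dihedral n)) = 2 * n"
  by (simp add: dihedral_def card_cartesian_product)

lemma rotation_pow: "rotation n [^]\<^bsub>dihedral n\<^esub> k = (int k mod int n, False)"
  by (induction k) (auto simp: dihedral_def rotation_def mod_simps algebra_simps nat_pow_def)

lemma dihedral_relations:
  assumes "n > 0"
  shows "rotation n [^]\<^bsub>dihedral n\<^esub> n = \<one>\<^bsub>dihedral n\<^esub>"
    and "reflection \<otimes>\<^bsub>dihedral n\<^esub> reflection = \<one>\<^bsub>dihedral n\<^esub>"
    and "reflection \<otimes>\<^bsub>dihedral n\<^esub> rotation n = inv\<^bsub>dihedral n\<^esub> (rotation n) \<otimes>\<^bsub>dihedral n\<^esub> reflection"
proof -
  interpret group "dihedral n" by (rule dihedral_group[OF assms])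
  show "rotation n [^]\<^bsub>dihedral n\<^esub> n = \<one>\<^bsub>dihedral n\<^esub>"
    unfolding rotation_pow by (simp add: dihedral_def)
  show "reflection \<otimes>\<^bsub>dihedral n\<^esub> reflection = \<one>\<^bsub>dihedral n\<^esub>"
    by (simp add: dihedral_def reflection_def)
  have "inv\<^bsub>dihedral n\<^esub> (rotation n) = ((- 1) mod int n, False)"
    by (rule inv_equality) (use assms in \<open>auto simp: dihedral_def rotation_def mod_simps\<close>)
  then show "reflection \<otimes>\<^bsub>dihedral n\<^esub> rotation n = inv\<^bsub>dihedral n\<^esub> (rotation n) \<otimes>\<^bsub>dihedral n\<^esub> reflection"
    by (simp add: dihedral_def rotation_def reflection_def mod_simps)
qed

lemma dihedral_generated:
  assumes "x \<in> carrier (dihedral n)"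
  obtains a where "x = rotation n [^]\<^bsub>dihedral n\<^esub> (a :: nat)"
    | a where "x = rotation n [^]\<^bsub>dihedral n\<^esub> (a :: nat) \<otimes>\<^bsub>dihedral n\<^esub> reflection"
proof -
  obtain a s where x: "x = (a, s)" "0 \<le> a" "a < int n"
    using assms by (auto simp: dihedral_def)
  then have p: "rotation n [^]\<^bsub>dihedral n\<^esub> nat a = (a, False)"
    by (simp add: rotation_pow)
  show thesis
    using that(1)[of "nat a"] that(2)[of "nat a"] x p
    by (cases s) (auto simp: dihedral_def reflection_def)
qed

definition unitary_mats :: "nat \<Rightarrow> complex mat set" where
  "unitary_mats n =
    {U \<in> carrier_mat n n. U * mat_adjoint U = 1\<^sub>m n \<and> mat_adjoint U * U = 1\<^sub>m n}"

definition projective_unitary_rep ::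
    "nat \<Rightarrow> ('g, 'b) monoid_scheme \<Rightarrow> ('g \<Rightarrow> complex mat) \<Rightarrow> bool" where
  "projective_unitary_rep d G \<pi> \<longleftrightarrow>
    (\<forall>g\<in>carrier G. \<pi> g \<in> unitary_mats d) \<and>
    (\<forall>g\<in>carrier G. \<forall>h\<in>carrier G.
      \<exists>c. cmod c = 1 \<and> \<pi> (g \<otimes>\<^bsub>G\<^esub> h) = c \<cdot>\<^sub>m (\<pi> g * \<pi> h))"

definition unit_vector :: "nat \<Rightarrow> complex vec \<Rightarrow> bool" where
  "unit_vector d v \<longleftrightarrow> v \<in> carrier_vec d \<and> v \<bullet>c v = 1"

text \<open>
  The list starts with \<open>v\<close> itself, because \<open>\<pi>\<close> may send the neutral
  element to a unimodular multiple of the identity.  Being a basis as a family also requires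
  that there are no repetitions.
\<close>

definition regular :: "nat \<Rightarrow> (int \<times> bool \<Rightarrow> complex mat) \<Rightarrow> complex vec \<Rightarrow> bool" where
  "regular n \<pi> v \<longleftrightarrow>
    (let vs = v # map (\<lambda>k. \<pi> (rotation n [^]\<^bsub>dihedral n\<^esub> k) *\<^sub>v v) [1..<n]
     in distinct vs \<and>
        vectorspace.basis class_ring (module_vec TYPE(complex) n) (set vs))"

definition regular_dihedral_configuration ::
    "nat \<Rightarrow> (int \<times> bool \<Rightarrow> complex vec) \<Rightarrow> bool" where
  "regular_dihedral_configuration n \<phi> \<longleftrightarrow>
    (\<exists>\<pi> v. projective_unitary_rep n (dihedral n) \<pi> \<and> unit_vector n v \<and> regular n \<pi> v \<and>
      (\<forall>g\<in>carrier (dihedral n). \<phi> g = \<pi> g *\<^sub>v v))"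

definition tight_frame :: "nat \<Rightarrow> 'i set \<Rightarrow> ('i \<Rightarrow> complex vec) \<Rightarrow> bool" where
  "tight_frame d I \<phi> \<longleftrightarrow> finite I \<and> (\<forall>i\<in>I. \<phi> i \<in> carrier_vec d) \<and>
    (\<exists>A::real. A > 0 \<and>
      (\<forall>x\<in>carrier_vec d.
        complex_of_real (\<Sum>i\<in>I. (cmod (x \<bullet>c \<phi> i))\<^sup>2) = complex_of_real A * (x \<bullet>c x)))"

definition ETF :: "nat \<Rightarrow> nat \<Rightarrow> 'i set \<Rightarrow> ('i \<Rightarrow> complex vec) \<Rightarrow> bool" where
  "ETF N d I \<phi> \<longleftrightarrow> card I = N \<and> (\<forall>i\<in>I. unit_vector d (\<phi> i)) \<and> tight_frame d I \<phi> \<and>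
    (\<exists>c::real. \<forall>i\<in>I. \<forall>j\<in>I. i \<noteq> j \<longrightarrow> cmod (\<phi> i \<bullet>c \<phi> j) = c)"

end

theory Submission
  imports Defs "Jordan_Normal_Form.DL_Rank"
begin

text \<open>
  Let \<open>U\<close> and \<open>T\<close> represent the rotation and the reflection.  Rescaling them by phases gives
  \<open>T U = U\<^sup>-\<^sup>1 T\<close>, \<open>T\<^sup>2 = 1\<close> and \<open>U\<^sup>n = \<gamma>\<close> with \<open>\<gamma>\<^sup>2 = 1\<close>.  Regularity makes \<open>U\<close> a monomial matrix in
  the basis \<open>v, U v, \<dots>\<close>, so \<open>U\<^sup>k\<close> has trace 0 for \<open>0 < k < n\<close>; comparing this with the trace of \<open>U\<^sup>k\<close>
  times the frame operator shows that \<open>X k = \<langle>U\<^sup>k v, v\<rangle>\<close> is purely imaginary, while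
  \<open>Y k = \<langle>U\<^sup>k T v, v\<rangle>\<close> is always real.  Since \<open>X (n/2)\<close> is nonzero, \<open>\<gamma> = -1\<close>.  Up to the common
  modulus, \<open>X\<close> and \<open>Y\<close> are therefore negacyclic sign sequences \<open>e\<close> (odd, zero at multiples of
  \<open>n\<close>) and \<open>d\<close>, and tightness says that their negacyclic autocorrelations cancel.

  For \<open>n = 18\<close> such sequences do not exist.  Reducing modulo \<open>x\<^sup>6 + 1\<close>, a divisor of \<open>x\<^sup>1\<^sup>8 + 1\<close>,
  replaces the signs at \<open>k, k + 6, k + 12\<close> by one number in \<open>{\<plusminus>1, \<plusminus>3}\<close>; the squares of these
  numbers add up to 35, so few patterns survive the reduced correlation equations, and lifting
  the survivors back to signs is a small finite search.
\<close>

subsection \<open>Matrices and frames\<close>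

lemma index_mat_adjoint:
  assumes "A \<in> carrier_mat n m" "i < m" "j < n"
  shows "mat_adjoint A $$ (i, j) = conjugate (A $$ (j, i))"
  using assms by (simp add: mat_adjoint_def mat_of_rows_def)

lemma mat_adjoint_carrier: "A \<in> carrier_mat n m \<Longrightarrow> mat_adjoint A \<in> carrier_mat m n"
  by (auto simp: mat_adjoint_def mat_of_rows_def)

lemma cscalar_prod_mult_mat_vec:
  fixes A :: "complex mat"
  assumes A: "A \<in> carrier_mat n m" and x: "x \<in> carrier_vec m" and y: "y \<in> carrier_vec n"
  shows "(A *\<^sub>v x) \<bullet>c y = x \<bullet>c (mat_adjoint A *\<^sub>v y)"
proof -
  have "(A *\<^sub>v x) \<bullet>c y = (\<Sum>i<n. \<Sum>j<m. A $$ (i, j) * x $ j * cnj (y $ i))"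
    using assms by (simp add: scalar_prod_def sum_distrib_right lessThan_atLeast0)
  also have "\<dots> = (\<Sum>j<m. \<Sum>i<n. A $$ (i, j) * x $ j * cnj (y $ i))"
    by (rule sum.swap)
  also have "\<dots> = x \<bullet>c (mat_adjoint A *\<^sub>v y)"
    using assms mat_adjoint_carrier[OF A]
    by (auto simp: scalar_prod_def sum_distrib_left lessThan_atLeast0 index_mat_adjoint
        intro!: sum.cong)
  finally show ?thesis .
qed

lemma cscalar_prod_commute:
  fixes x y :: "complex vec"
  assumes "x \<in> carrier_vec n" "y \<in> carrier_vec n"
  shows "y \<bullet>c x = cnj (x \<bullet>c y)"
  using assms by (simp add: scalar_prod_def mult.commute)

definition mat_trace :: "'a :: comm_ring_1 mat \<Rightarrow> 'a" where
  "mat_trace A = (\<Sum>i<dim_row A. A $$ (i, i))"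

lemma mat_trace_commute:
  assumes "A \<in> carrier_mat n m" "B \<in> carrier_mat m n"
  shows "mat_trace (A * B) = mat_trace (B * A)"
proof -
  have "mat_trace (A * B) = (\<Sum>i<n. \<Sum>j<m. A $$ (i, j) * B $$ (j, i))"
    using assms by (simp add: mat_trace_def scalar_prod_def lessThan_atLeast0)
  also have "\<dots> = (\<Sum>j<m. \<Sum>i<n. A $$ (i, j) * B $$ (j, i))"
    by (rule sum.swap)
  also have "\<dots> = mat_trace (B * A)"
    using assms by (simp add: mat_trace_def scalar_prod_def lessThan_atLeast0 mult.commute)
  finally show ?thesis .
qed

text \<open>Conjugation by \<open>V\<close> preserves the trace. The diagonal of the conjugate holds
  the coefficient of each basis vector in its own image, and these all vanish.\<close>

lemma mat_trace_permuted_basis: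
  fixes V :: "'a :: field mat"
  assumes M: "M \<in> carrier_mat n n" and V: "V \<in> carrier_mat n n" and "det V \<noteq> 0"
    and shift: "\<And>m. m < n \<Longrightarrow> \<exists>j c. j < n \<and> j \<noteq> m \<and> M *\<^sub>v col V m = c \<cdot>\<^sub>v col V j"
  shows "mat_trace M = 0"
proof -
  obtain R where R: "R \<in> carrier_mat n n" "R * V = 1\<^sub>m n" "V * R = 1\<^sub>m n"
    using det_non_zero_imp_unit[OF V \<open>det V \<noteq> 0\<close>, unfolded Units_def ring_mat_def] by auto
  have "(R * (M * V)) $$ (m, m) = 0" if m: "m < n" for m
  proof -
    obtain j c where j: "j < n" "j \<noteq> m" "M *\<^sub>v col V m = c \<cdot>\<^sub>v col V j"
      using shift[OF m] by blast
    have "(R * (M * V)) $$ (m, m) = row R m \<bullet> col (M * V) m"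
      using R(1) M V m by (intro index_mult_mat) auto
    also have "\<dots> = row R m \<bullet> (M *\<^sub>v col V m)"
      by (simp only: col_mult2[OF M V m])
    also have "\<dots> = c * (row R m \<bullet> col V j)"
      using R(1) V m j by simp
    also have "row R m \<bullet> col V j = (R * V) $$ (m, j)"
      using R(1) V m j by simp
    finally show ?thesis
      unfolding R(2) using m j by simp
  qed
  then have "mat_trace (R * (M * V)) = 0"
    using R by (simp add: mat_trace_def)
  moreover have "mat_trace (R * (M * V)) = mat_trace (M * V * R)"
    using R M V by (intro mat_trace_commute) auto
  moreover have "M * V * R = M"
    using R M V by simp
  ultimately show ?thesis by simp
qed

text \<open>Complex polarisation: the defect \<open>Q\<close> of the identity is sesquilinear and
  vanishes on the diagonal.\<close>

lemma tight_frame_polarization: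
  fixes A :: complex
  assumes dim: "\<And>i. i \<in> I \<Longrightarrow> \<phi> i \<in> carrier_vec n"
    and tight: "\<And>x. x \<in> carrier_vec n \<Longrightarrow>
      (\<Sum>i\<in>I. of_real ((cmod (x \<bullet>c \<phi> i))\<^sup>2)) = A * (x \<bullet>c x)"
    and x: "x \<in> carrier_vec n" and y: "y \<in> carrier_vec n"
  shows "(\<Sum>i\<in>I. (x \<bullet>c \<phi> i) * (\<phi> i \<bullet>c y)) = A * (x \<bullet>c y)"
proof -
  define Q where "Q x y = (\<Sum>i\<in>I. (x \<bullet>c \<phi> i) * (\<phi> i \<bullet>c y)) - A * (x \<bullet>c y)" for x y
  have Q0: "Q x x = 0" if x: "x \<in> carrier_vec n" for x
  proof -
    have "(x \<bullet>c \<phi> i) * (\<phi> i \<bullet>c x) = of_real ((cmod (x \<bullet>c \<phi> i))\<^sup>2)" if "i \<in> I" for i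
      unfolding complex_norm_square by (simp add: cscalar_prod_commute[OF x dim[OF that]])
    then show ?thesis using tight[OF x] by (simp add: Q_def)
  qed
  have add: "Q (x + c \<cdot>\<^sub>v y) (x + c \<cdot>\<^sub>v y) = Q x x + cnj c * Q x y + c * Q y x + c * cnj c * Q y y"
    if x: "x \<in> carrier_vec n" and y: "y \<in> carrier_vec n" for x y c
  proof -
    have *: "((x + c \<cdot>\<^sub>v y) \<bullet>c z) = x \<bullet>c z + c * (y \<bullet>c z)"
      "z \<bullet>c (x + c \<cdot>\<^sub>v y) = z \<bullet>c x + cnj c * (z \<bullet>c y)" if "z \<in> carrier_vec n" for z
      using x y that
      by (auto simp: add_scalar_prod_distrib[of _ n] conjugate_add_vec[of _ n]
          conjugate_smult_vec scalar_prod_add_distrib[of _ n])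
    show ?thesis
      unfolding Q_def using x y
      by (simp add: * dim algebra_simps sum.distrib sum_distrib_left)
  qed
  have "cnj c * Q x y + c * Q y x = 0" for c
    using add[OF x y, of c] Q0[OF x] Q0[OF y] Q0[of "x + c \<cdot>\<^sub>v y"] x y by simp
  \<comment> \<open>The value 1 shows that \<open>Q\<close> changes sign when \<open>x\<close> and
    \<open>y\<close> are exchanged, the imaginary unit that it does not.\<close>
  from this[of 1] this[of \<i>] have "Q x y + Q y x = 0" "\<i> * (Q y x - Q x y) = 0"
    by (simp_all add: algebra_simps)
  then have "Q x y = 0" by simp
  then show ?thesis by (simp add: Q_def)
qed

lemma (in vec_space) det_nonzero_if_basis:
  assumes len: "length ws = n" and "distinct ws" and basis: "basis (set ws)"
  shows "det (mat_of_cols n ws) \<noteq> 0"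
proof -
  have ws: "set ws \<subseteq> carrier_vec n" "lin_indpt (set ws)"
    using basis unfolding basis_def by auto
  then have "cols (mat_of_cols n ws) = ws" by simp
  then have "rank (mat_of_cols n ws) = n"
    using lin_indpt_full_rank[of "mat_of_cols n ws" n] assms ws(2)
    by (metis mat_of_cols_carrier(1))
  then show ?thesis
    using det_rank_iff[of "mat_of_cols n ws"] len by (metis mat_of_cols_carrier(1))
qed

lemma pow_mat_add:
  assumes "A \<in> carrier_mat n n"
  shows "A ^\<^sub>m (k + l) = A ^\<^sub>m k * A ^\<^sub>m l"
  using assms by (induction l) (auto simp: assoc_mult_mat[of _ n n _ n _ n, symmetric])

text \<open>The sum is the trace of \<open>M\<close> composed with the rank-one operator of
  \<open>u\<close>: \<open>col M i\<close> is the image of a unit vector, and expanding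
  \<open>u\<close> in the unit vectors collapses it.\<close>

lemma sum_col_cscalar_prod:
  fixes M :: "complex mat"
  assumes M: "M \<in> carrier_mat n n" and u: "u \<in> carrier_vec n"
  shows "(\<Sum>i<n. (col M i \<bullet>c u) * (u \<bullet>c unit_vec n i)) = (M *\<^sub>v u) \<bullet>c u"
proof -
  have "u \<bullet>c unit_vec n i = u $ i" if "i < n" for i
  proof -
    have "conjugate (unit_vec n i :: complex vec) = unit_vec n i"
      by (auto simp: unit_vec_def)
    then show ?thesis using u that by simp
  qed
  then have "(\<Sum>i<n. (col M i \<bullet>c u) * (u \<bullet>c unit_vec n i))
      = (\<Sum>i<n. \<Sum>j<n. M $$ (j, i) * cnj (u $ j) * u $ i)"
    using M u by (simp add: scalar_prod_def lessThan_atLeast0 sum_distrib_right)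
  also have "\<dots> = (\<Sum>j<n. \<Sum>i<n. M $$ (j, i) * cnj (u $ j) * u $ i)"
    by (rule sum.swap)
  also have "\<dots> = (M *\<^sub>v u) \<bullet>c u"
    using M u by (simp add: scalar_prod_def lessThan_atLeast0 sum_distrib_right sum_distrib_left mult_ac)
  finally show ?thesis .
qed

text \<open>The codomain is arbitrary because this is also applied to norms and to the truth value
  of an equation.\<close>

lemma periodic_mod:
  fixes f :: "int \<Rightarrow> 'a"
  assumes per: "\<And>k. f (k + N) = f k"
  shows "f (k mod N) = f k"
proof -
  have nat: "f (k + int m * N) = f k" for k m
  proof (induction m)
    case (Suc m)
    have "f (k + int (Suc m) * N) = f (k + int m * N + N)" by (simp add: algebra_simps)
    then show ?case using per Suc.IH by simp
  qed simp
  have "f (k mod N) = f (k mod N + k div N * N)"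
  proof (cases "k div N \<ge> 0")
    case True
    then show ?thesis using nat[of "k mod N" "nat (k div N)"] by simp
  next
    \<comment> \<open>A negative quotient is undone by adding periods to \<open>k\<close>
      itself.\<close>
    case False
    then show ?thesis
      using nat[of "k mod N + k div N * N" "nat (- (k div N))"] by (simp add: minus_div_mult_eq_mod)
  qed
  then show ?thesis by simp
qed

text \<open>The generators after rescaling by phases. As \<open>\<gamma> * \<gamma> = 1\<close>, the
  power \<open>2 * n\<close> of \<open>U\<close> is the identity, so the exponent
  \<open>2 * n - 1\<close> stands for the inverse. \<open>A\<close> is the frame bound,
  \<open>c\<close> the common modulus.\<close>

locale dihedral_frame =
  fixes n :: nat and U T :: "complex mat" and v :: "complex vec" and \<gamma> :: complex and A c :: real
  assumes n: "n > 0" "even n"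
    and U_unitary: "U \<in> unitary_mats n" and T_unitary: "T \<in> unitary_mats n"
    and U_pow_n: "U ^\<^sub>m n = \<gamma> \<cdot>\<^sub>m 1\<^sub>m n" and gamma_square: "\<gamma> * \<gamma> = 1"
    and TU: "T * U = U ^\<^sub>m (2 * n - 1) * T" and TT: "T * T = 1\<^sub>m n"
    and v: "v \<in> carrier_vec n" "v \<bullet>c v = 1"
    and frame: "\<And>x y. x \<in> carrier_vec n \<Longrightarrow> y \<in> carrier_vec n \<Longrightarrow>
      (\<Sum>k<n. (x \<bullet>c (U ^\<^sub>m k *\<^sub>v v)) * ((U ^\<^sub>m k *\<^sub>v v) \<bullet>c y)
        + (x \<bullet>c (U ^\<^sub>m k *\<^sub>v (T *\<^sub>v v))) * ((U ^\<^sub>m k *\<^sub>v (T *\<^sub>v v)) \<bullet>c y)) = A * (x \<bullet>c y)"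
    and rotation_modulus: "\<And>k. 0 < k \<Longrightarrow> k < n \<Longrightarrow> cmod ((U ^\<^sub>m k *\<^sub>v v) \<bullet>c v) = c"
    and reflection_modulus: "\<And>k. k < n \<Longrightarrow> cmod ((U ^\<^sub>m k *\<^sub>v (T *\<^sub>v v)) \<bullet>c v) = c"
    and trace_zero: "\<And>k. 0 < k \<Longrightarrow> k < n \<Longrightarrow> mat_trace (U ^\<^sub>m k) = 0"
begin

text \<open>Exponents are reduced modulo \<open>2 * n\<close> and not \<open>n\<close>, because the
  \<open>n\<close>-th power of \<open>U\<close> is the scalar \<open>\<gamma>\<close>. Negative
  powers then need no inverse matrix.\<close>

definition P :: "int \<Rightarrow> complex mat" where
  "P k = U ^\<^sub>m nat (k mod (2 * int n))"

definition X :: "int \<Rightarrow> complex" where "X k = (P k *\<^sub>v v) \<bullet>c v"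
definition Y :: "int \<Rightarrow> complex" where "Y k = (P k *\<^sub>v (T *\<^sub>v v)) \<bullet>c v"

lemma carriers [simp]: "U \<in> carrier_mat n n" "T \<in> carrier_mat n n" "v \<in> carrier_vec n"
    "P k \<in> carrier_mat n n"
  using U_unitary T_unitary v(1) by (auto simp: unitary_mats_def P_def)

lemma dims [simp]: "dim_row U = n" "dim_col U = n" "dim_row T = n" "dim_col T = n"
    "dim_vec v = n" "dim_row (P k) = n" "dim_col (P k) = n"
  using carriers carriers(4)[of k] by (auto simp del: carriers)

lemma mult_carriers [simp]: "x \<in> carrier_vec n \<Longrightarrow> P k *\<^sub>v x \<in> carrier_vec n"
    "x \<in> carrier_vec n \<Longrightarrow> T *\<^sub>v x \<in> carrier_vec n"
  by (auto intro!: mult_mat_vec_carrier)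

lemma U_pow_2n: "U ^\<^sub>m (2 * n * q) = 1\<^sub>m n"
proof (induction q)
  case 0
  show ?case by simp
next
  case (Suc q)
  have "2 * n * Suc q = 2 * n * q + (n + n)" by simp
  then have "U ^\<^sub>m (2 * n * Suc q) = U ^\<^sub>m (2 * n * q) * (U ^\<^sub>m n * U ^\<^sub>m n)"
    by (metis carriers(1) pow_mat_add)
  also have "U ^\<^sub>m n * U ^\<^sub>m n = 1\<^sub>m n"
    unfolding U_pow_n using gamma_square
    by (auto simp: mult_smult_distrib[of _ n n] mult_smult_assoc_mat[of _ n n])
  finally show ?case using Suc.IH by simp
qed

lemma U_pow_mod: "U ^\<^sub>m (k mod (2 * n)) = U ^\<^sub>m k"
proof -
  have "U ^\<^sub>m k = U ^\<^sub>m (2 * n * (k div (2 * n)) + k mod (2 * n))" by simp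
  also have "\<dots> = U ^\<^sub>m (k mod (2 * n))"
    unfolding pow_mat_add[OF carriers(1)] U_pow_2n
    by (rule left_mult_one_mat[of _ n n]) simp
  finally show ?thesis ..
qed

lemma P_of_nat: "P (int k) = U ^\<^sub>m k"
  unfolding P_def using U_pow_mod[of k] by (metis nat_int of_nat_mod of_nat_mult of_nat_numeral)

lemma P_0 [simp]: "P 0 = 1\<^sub>m n"
  using P_of_nat[of 0] carriers(1) by simp

lemma P_mod: "P (k mod (2 * int n)) = P k"
  by (simp add: P_def)

text \<open>Reduces claims about \<open>P k\<close> and \<open>P (- k)\<close> to natural exponents,
  where induction is available.\<close>

lemma P_cases: obtains m where "P k = P (int m)" "P (- k) = P (- int m)"
proof
  have *: "int (nat (k mod (2 * int n))) = k mod (2 * int n)" using n by simp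
  show "P k = P (int (nat (k mod (2 * int n))))"
    "P (- k) = P (- int (nat (k mod (2 * int n))))"
    unfolding * by (metis P_mod) (metis P_mod mod_minus_eq)
qed

lemma P_add: "P (k + l) = P k * P l"
proof -
  have "P k * P l = U ^\<^sub>m (nat (k mod (2 * int n)) + nat (l mod (2 * int n)))"
    by (simp add: P_def pow_mat_add[OF carriers(1)])
  also have "\<dots> = P (int (nat (k mod (2 * int n)) + nat (l mod (2 * int n))))"
    by (rule P_of_nat[symmetric])
  also have "int (nat (k mod (2 * int n)) + nat (l mod (2 * int n))) =
      k mod (2 * int n) + l mod (2 * int n)"
    using n by simp
  also have "P \<dots> = P (k + l)"
    by (metis P_mod mod_add_eq)
  finally show ?thesis ..
qed

lemma P_mult_vec: "x \<in> carrier_vec n \<Longrightarrow> P k *\<^sub>v (P l *\<^sub>v x) = P (k + l) *\<^sub>v x"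
  unfolding P_add by (rule assoc_mult_mat_vec[symmetric, of _ n n _ n]) auto

lemma P_add_n: "P (k + int n) = \<gamma> \<cdot>\<^sub>m P k"
  unfolding P_add P_of_nat U_pow_n
  using mult_smult_distrib[of "P k" n n "1\<^sub>m n" n \<gamma>] right_mult_one_mat[of "P k" n n] by simp

lemma P_adjoint:
  assumes "x \<in> carrier_vec n" "y \<in> carrier_vec n"
  shows "(P k *\<^sub>v x) \<bullet>c y = x \<bullet>c (P (- k) *\<^sub>v y)"
proof -
  have U1: "P 1 = U" using P_of_nat[of 1] by simp
  \<comment> \<open>\<open>P (- 1)\<close> is the inverse of the unitary \<open>U\<close>, hence its
    adjoint.\<close>
  have adj: "mat_adjoint U = P (- 1)"
  proof -
    have ac: "mat_adjoint U \<in> carrier_mat n n" by (rule mat_adjoint_carrier) simp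
    have "U * P (- 1) = 1\<^sub>m n" using P_add[of 1 "-1"] U1 by simp
    then have "mat_adjoint U = mat_adjoint U * (U * P (- 1))" using ac by simp
    also have "\<dots> = (mat_adjoint U * U) * P (- 1)"
      using ac by (intro assoc_mult_mat[symmetric, of _ n n _ n _ n]) auto
    also have "\<dots> = P (- 1)" using U_unitary by (simp add: unitary_mats_def)
    finally show ?thesis .
  qed
  have nat: "(P (int m) *\<^sub>v x) \<bullet>c y = x \<bullet>c (P (- int m) *\<^sub>v y)" if "x \<in> carrier_vec n" for m x
    using that
  proof (induction m arbitrary: x)
    case 0
    then show ?case using assms by simp
  next
    case (Suc m)
    have "(P (int (Suc m)) *\<^sub>v x) \<bullet>c y = (P (int m) *\<^sub>v (P 1 *\<^sub>v x)) \<bullet>c y"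
      using Suc.prems by (simp add: P_mult_vec add.commute)
    also have "\<dots> = (U *\<^sub>v x) \<bullet>c (P (- int m) *\<^sub>v y)"
      using Suc.IH[of "P 1 *\<^sub>v x"] mult_carriers(1)[OF Suc.prems, of 1] unfolding U1 by simp
    also have "\<dots> = x \<bullet>c (P (- 1) *\<^sub>v (P (- int m) *\<^sub>v y))"
      using Suc.prems assms adj cscalar_prod_mult_mat_vec[of U n n x "P (- int m) *\<^sub>v y"] by simp
    finally show ?case using assms by (simp add: P_mult_vec)
  qed
  obtain m where "P k = P (int m)" "P (- k) = P (- int m)" by (rule P_cases)
  then show ?thesis using nat[OF assms(1)] by simp
qed

text \<open>A unitary involution is self-adjoint.\<close>

lemma T_adjoint:
  assumes "x \<in> carrier_vec n" "y \<in> carrier_vec n"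
  shows "(T *\<^sub>v x) \<bullet>c y = x \<bullet>c (T *\<^sub>v y)"
proof -
  have ac: "mat_adjoint T \<in> carrier_mat n n" by (rule mat_adjoint_carrier) simp
  have "mat_adjoint T = mat_adjoint T * (T * T)" using ac TT by simp
  also have "\<dots> = (mat_adjoint T * T) * T"
    using ac by (intro assoc_mult_mat[symmetric, of _ n n _ n _ n]) auto
  also have "\<dots> = T" using T_unitary by (simp add: unitary_mats_def)
  finally show ?thesis
    using cscalar_prod_mult_mat_vec[of T n n x y] assms by simp
qed

lemma T_P: "T * P k = P (- k) * T"
proof -
  \<comment> \<open>Adding a full period turns the exponent -1 into the natural one that occurs in
    \<open>TU\<close>.\<close>
  have "P (- 1) = P (- 1 + 2 * int n)"
    by (subst (1 2) P_mod[symmetric]) simp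
  also have "- 1 + 2 * int n = int (2 * n - 1)" using n(1) by simp
  finally have m1: "P (- 1) = U ^\<^sub>m (2 * n - 1)" unfolding P_of_nat .
  have nat: "T * P (int m) = P (- int m) * T" for m
  proof (induction m)
    case 0
    show ?case using left_mult_one_mat[OF carriers(2)] right_mult_one_mat[OF carriers(2)] by simp
  next
    case (Suc m)
    have "T * P (int (Suc m)) = T * (P (int m) * P 1)"
      by (simp add: P_add[symmetric] add.commute)
    also have "\<dots> = (T * P (int m)) * P 1"
      by (intro assoc_mult_mat[symmetric, of _ n n _ n _ n]) auto
    also have "\<dots> = P (- int m) * (T * P 1)"
      unfolding Suc.IH by (intro assoc_mult_mat[of _ n n _ n _ n]) auto
    also have "T * P 1 = P (- 1) * T"
      using TU m1 P_of_nat[of 1] by simp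
    also have "P (- int m) * (P (- 1) * T) = (P (- int m) * P (- 1)) * T"
      by (intro assoc_mult_mat[symmetric, of _ n n _ n _ n]) auto
    also have "P (- int m) * P (- 1) = P (- int (Suc m))"
      by (simp add: P_add[symmetric] algebra_simps)
    finally show ?case .
  qed
  obtain m where "P k = P (int m)" "P (- k) = P (- int m)" by (rule P_cases)
  then show ?thesis using nat[of m] by simp
qed

lemma T_P_vec: "x \<in> carrier_vec n \<Longrightarrow> T *\<^sub>v (P k *\<^sub>v x) = P (- k) *\<^sub>v (T *\<^sub>v x)"
  using T_P[of k] by (simp flip: assoc_mult_mat_vec[of _ n n _ n])

lemma T_T_vec: "x \<in> carrier_vec n \<Longrightarrow> T *\<^sub>v (T *\<^sub>v x) = x"
  using TT by (simp flip: assoc_mult_mat_vec[of _ n n _ n])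

section \<open>Inner products along the orbit\<close>

lemma X_0: "X 0 = 1"
  by (simp add: X_def v)

lemma X_minus: "X (- k) = cnj (X k)"
  unfolding X_def by (simp add: P_adjoint cscalar_prod_commute[of "P k *\<^sub>v v" n v])

text \<open>\<open>P k * T\<close> is again a self-adjoint involution, so its quadratic form is
  real.\<close>

lemma Y_real: "cnj (Y k) = Y k"
proof -
  have "cnj (Y k) = v \<bullet>c (P k *\<^sub>v (T *\<^sub>v v))"
    unfolding Y_def by (rule cscalar_prod_commute[symmetric, of _ n]) auto
  also have "\<dots> = (P (- k) *\<^sub>v v) \<bullet>c (T *\<^sub>v v)" by (simp add: P_adjoint)
  also have "\<dots> = (T *\<^sub>v (P (- k) *\<^sub>v v)) \<bullet>c v" by (simp add: T_adjoint)
  also have "\<dots> = Y k" by (simp add: T_P_vec Y_def)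
  finally show ?thesis .
qed

lemma smult_mat_vec:
  "x \<in> carrier_vec n \<Longrightarrow> (a \<cdot>\<^sub>m P k *\<^sub>v x) \<bullet>c y = a * ((P k *\<^sub>v x) \<bullet>c y)" if "y \<in> carrier_vec n"
  using that by (simp add: scalar_prod_def sum_distrib_left mult_ac)

lemma X_add_n: "X (k + int n) = \<gamma> * X k"
  unfolding X_def P_add_n by (rule smult_mat_vec) auto

lemma Y_add_n: "Y (k + int n) = \<gamma> * Y k"
  unfolding Y_def P_add_n by (rule smult_mat_vec) auto

text \<open>The frame identity at \<open>x = P s *\<^sub>v v\<close> and \<open>y = v\<close>; all
  inner products depend only on differences of indices.\<close>

lemma frame_correlation:
  "(\<Sum>k<n. X (s - int k) * X (int k) + Y (int k - s) * Y (int k)) = A * X s"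
proof -
  have "(P s *\<^sub>v v) \<bullet>c (P k *\<^sub>v (T *\<^sub>v v)) = Y (k - s)" for k
  proof -
    have "(P s *\<^sub>v v) \<bullet>c (P k *\<^sub>v (T *\<^sub>v v)) = v \<bullet>c (P (k - s) *\<^sub>v (T *\<^sub>v v))"
      by (simp add: P_adjoint P_mult_vec)
    also have "\<dots> = cnj (Y (k - s))"
      unfolding Y_def by (rule cscalar_prod_commute[of _ n]) auto
    finally show ?thesis by (simp add: Y_real)
  qed
  moreover have "(P s *\<^sub>v v) \<bullet>c (P k *\<^sub>v v) = X (s - k)" for k
    using P_adjoint[of "P s *\<^sub>v v" v "- k"] by (simp add: P_mult_vec X_def)
  ultimately show ?thesis
    using frame[of "P s *\<^sub>v v" v] by (simp add: X_def Y_def flip: P_of_nat)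
qed

text \<open>The trace of \<open>P k\<close> times the frame operator, computed twice. The operator
  is \<open>A\<close> times the identity. On the other hand, each rotated copy of \<open>v\<close>
  contributes \<open>X k\<close>, and each reflected one \<open>X (- k)\<close>, since conjugation
  by \<open>T\<close> inverts \<open>P k\<close>.\<close>

lemma frame_trace: "of_nat n * (X k + X (- k)) = A * mat_trace (P k)"
proof -
  have unit: "unit_vec n i \<in> carrier_vec n" for i by simp
  have col: "col (P k) i \<in> carrier_vec n" for i
    using col_dim[of "P k" i] by simp
  have diag: "col (P k) i \<bullet>c unit_vec n i = P k $$ (i, i)" if "i < n" for i
  proof -
    have "conjugate (unit_vec n i :: complex vec) = unit_vec n i"
      by (auto simp: unit_vec_def)
    then show ?thesis using that carriers(4)[of k] by simp
  qed
  have inner: "(P k *\<^sub>v (P m *\<^sub>v x)) \<bullet>c (P m *\<^sub>v x) = (P k *\<^sub>v x) \<bullet>c x"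
    if "x \<in> carrier_vec n" for m x
    using that P_adjoint[of "P k *\<^sub>v (P m *\<^sub>v x)" x "- m"] by (simp add: P_mult_vec)
  have reflected: "(P k *\<^sub>v (T *\<^sub>v v)) \<bullet>c (T *\<^sub>v v) = X (- k)"
    using T_adjoint[of "P k *\<^sub>v (T *\<^sub>v v)" v] by (simp add: T_P_vec T_T_vec X_def)
  have "A * mat_trace (P k) = (\<Sum>i<n. A * (col (P k) i \<bullet>c unit_vec n i))"
    using diag carriers(4)[of k] by (simp add: mat_trace_def sum_distrib_left)
  \<comment> \<open>The frame identity with \<open>x\<close> the image of the i-th unit vector and
    \<open>y\<close> that unit vector.\<close>
  also have "\<dots> = (\<Sum>i<n. \<Sum>m<n.
      (col (P k) i \<bullet>c (P (int m) *\<^sub>v v)) * ((P (int m) *\<^sub>v v) \<bullet>c unit_vec n i)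
      + (col (P k) i \<bullet>c (P (int m) *\<^sub>v (T *\<^sub>v v))) * ((P (int m) *\<^sub>v (T *\<^sub>v v)) \<bullet>c unit_vec n i))"
    unfolding P_of_nat using frame[OF col unit] by simp
  also have "\<dots> = (\<Sum>m<n. \<Sum>i<n.
      (col (P k) i \<bullet>c (P (int m) *\<^sub>v v)) * ((P (int m) *\<^sub>v v) \<bullet>c unit_vec n i)
      + (col (P k) i \<bullet>c (P (int m) *\<^sub>v (T *\<^sub>v v))) * ((P (int m) *\<^sub>v (T *\<^sub>v v)) \<bullet>c unit_vec n i))"
    by (rule sum.swap)
  also have "\<dots> = (\<Sum>m<n. X k + X (- k))"
    by (intro sum.cong refl)
      (simp add: sum.distrib sum_col_cscalar_prod inner reflected, simp add: X_def)
  finally show ?thesis by simp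
qed

text \<open>The trace identity at \<open>k = 0\<close>: there are \<open>2 * n\<close> unit vectors
  in dimension \<open>n\<close>.\<close>

lemma A_eq: "A = 2"
proof -
  have "of_nat n * (2 :: complex) = of_nat n * complex_of_real A"
    using frame_trace[of 0] by (simp add: X_0 mat_trace_def mult.commute)
  then have "complex_of_real A = of_real 2" using n(1) by simp
  then show ?thesis unfolding of_real_eq_iff .
qed

lemma X_imaginary:
  assumes "0 < k" "k < int n"
  shows "X k + X (- k) = 0"
proof -
  obtain m where "k = int m" "0 < m" "m < n"
    using assms by (metis of_nat_0_less_iff of_nat_less_iff zero_less_imp_eq_int)
  then show ?thesis
    using frame_trace[of k] trace_zero[of m] n by (simp add: P_of_nat)
qed

lemma modulus_X: "0 < k \<Longrightarrow> k < n \<Longrightarrow> cmod (X (int k)) = c"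
  by (simp add: X_def P_of_nat rotation_modulus)

lemma modulus_Y: "k < n \<Longrightarrow> cmod (Y (int k)) = c"
  by (simp add: Y_def P_of_nat reflection_modulus)

text \<open>With \<open>c = 0\<close> only \<open>X 0 = 1\<close> would survive, and the correlation
  identity at shift 0 would read 1 = 2.\<close>

lemma c_nonzero: "c \<noteq> 0"
proof
  assume "c = 0"
  then have "X (int k) = (if k = 0 then 1 else 0)" "Y (int k) = 0" if "k < n" for k
    using modulus_X[of k] modulus_Y[of k] that by (auto simp: X_0)
  then have "(\<Sum>k<n. X (0 - int k) * X (int k) + Y (int k - 0) * Y (int k)) =
      (\<Sum>k<n. if k = 0 then 1 else 0)"
    by (intro sum.cong) (auto simp: X_0)
  then show False
    using frame_correlation[of 0] n(1) by (simp add: A_eq X_0)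
qed

text \<open>At half of the even number \<open>n\<close>, the indices \<open>h\<close> and
  \<open>- h\<close> differ by \<open>n\<close>, so
  \<open>X h = \<gamma> * X (- h) = - \<gamma> * X h\<close>, and \<open>X h\<close> is
  nonzero.\<close>

lemma gamma_eq: "\<gamma> = - 1"
proof -
  define h where "h = int (n div 2)"
  have h: "0 < h" "h < int n" "- h + int n = h" using n by (auto simp: h_def elim!: evenE)
  have X: "X h \<noteq> 0" using modulus_X[of "n div 2"] c_nonzero h by (auto simp: h_def)
  have "X (- h) = - X h"
    using X_imaginary[OF h(1,2)] by (simp add: eq_neg_iff_add_eq_0 add.commute)
  then have "X h = \<gamma> * (- X h)" using X_add_n[of "- h"] h(3) by simp
  then have "X h - \<gamma> * (- X h) = 0" unfolding right_minus_eq .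
  then have "(1 + \<gamma>) * X h = 0" by (simp add: algebra_simps)
  with X show ?thesis by (simp add: eq_neg_iff_add_eq_0 add.commute)
qed

lemma X_reflect: "\<not> int n dvd k \<Longrightarrow> X k + X (- k) = 0"
proof -
  assume k: "\<not> int n dvd k"
  have "X (k + int n) + X (- (k + int n)) = - (X k + X (- k))" for k
    using X_add_n[of k] X_add_n[of "- (k + int n)"] by (simp add: gamma_eq)
  then have "X (k + int n) + X (- (k + int n)) = 0 \<longleftrightarrow> X k + X (- k) = 0" for k
    by (simp only: neg_equal_0_iff_equal)
  \<comment> \<open>A shift by \<open>n\<close> negates the sum, so the truth of the equation is
    \<open>n\<close>-periodic.\<close>
  from periodic_mod[of "\<lambda>k. X k + X (- k) = 0", OF this, of k]
  show ?thesis using X_imaginary[of "k mod int n"] k n(1)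
    by (simp add: dvd_eq_mod_eq_0 order.not_eq_order_implies_strict)
qed

lemma c_pos: "c > 0"
  using c_nonzero modulus_Y[of 0] n(1) by (metis norm_ge_zero order_le_less)

lemma norm_X: "\<not> int n dvd k \<Longrightarrow> cmod (X k) = c"
proof -
  assume k: "\<not> int n dvd k"
  have "cmod (X (k mod int n)) = c"
    using modulus_X[of "nat (k mod int n)"] k n(1)
    by (simp add: dvd_eq_mod_eq_0 order.not_eq_order_implies_strict nat_less_iff)
  then show ?thesis
    using periodic_mod[of "\<lambda>k. cmod (X k)" "int n" k] by (simp add: X_add_n gamma_eq)
qed

lemma norm_Y: "cmod (Y k) = c"
proof -
  have "cmod (Y (k mod int n)) = c"
    using modulus_Y[of "nat (k mod int n)"] n(1) by (simp add: nat_less_iff)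
  then show ?thesis
    using periodic_mod[of "\<lambda>k. cmod (Y k)" "int n" k] by (simp add: Y_add_n gamma_eq)
qed

section \<open>Extraction of the two sign sequences\<close>

definition e :: "int \<Rightarrow> int" where
  "e k = (if int n dvd k then 0 else if Im (X k) > 0 then 1 else - 1)"

definition d :: "int \<Rightarrow> int" where
  "d k = (if Re (Y k) > 0 then 1 else - 1)"

lemma X_eq:
  assumes "\<not> int n dvd k"
  shows "X k = \<i> * of_real c * of_int (e k)"
proof -
  have re: "Re (X k) = 0" using X_reflect[OF assms] by (simp add: X_minus complex_eq_iff)
  then have "\<bar>Im (X k)\<bar> = c" using norm_X[OF assms] by (simp add: cmod_eq_Im)
  then show ?thesis using re c_pos assms by (auto simp: e_def complex_eq_iff)
qed

lemma Y_eq: "Y k = of_real c * of_int (d k)"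
proof -
  have im: "Im (Y k) = 0" using Y_real[of k] by (simp add: complex_eq_iff)
  then have "\<bar>Re (Y k)\<bar> = c" using norm_Y[of k] by (simp add: cmod_eq_Re)
  then show ?thesis using im c_pos by (auto simp: d_def complex_eq_iff)
qed

lemma e_sign: "\<not> int n dvd k \<Longrightarrow> e k \<in> {1, - 1}"
  by (simp add: e_def)

lemma e_zero: "e 0 = 0"
  by (simp add: e_def)

lemma d_sign: "d k \<in> {1, - 1}"
  by (simp add: d_def)

lemma e_minus: "e (- k) = - e k"
proof (cases "int n dvd k")
  case False
  then have "\<i> * of_real c * of_int (e k + e (- k)) = (0 :: complex)"
    using X_reflect[OF False] X_eq[of k] X_eq[of "- k"] by (simp add: algebra_simps)
  then have "e k + e (- k) = 0" using c_pos by (simp del: of_int_add)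
  then show ?thesis by simp
qed (simp add: e_def)

lemma e_add_n: "e (k + int n) = - e k"
proof (cases "int n dvd k")
  case False
  then have "\<i> * of_real c * of_int (e (k + int n) + e k) = (0 :: complex)"
    using X_add_n[of k] X_eq[of k] X_eq[of "k + int n"] by (simp add: algebra_simps gamma_eq)
  then have "e (k + int n) + e k = 0" using c_pos by (simp del: of_int_add)
  then show ?thesis by simp
qed (simp add: e_def)

lemma d_add_n: "d (k + int n) = - d k"
proof -
  have "of_real c * of_int (d (k + int n) + d k) = (0 :: complex)"
    using Y_add_n[of k] Y_eq[of k] Y_eq[of "k + int n"] by (simp add: algebra_simps gamma_eq)
  then have "d (k + int n) + d k = 0" using c_pos by (simp del: of_int_add)
  then show ?thesis by simp
qed

text \<open>The products containing \<open>X 0 = 1\<close>, at \<open>k = 0\<close> and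
  \<open>k = s\<close>, add up to \<open>2 * X s\<close> and cancel the right-hand side, as
  \<open>A = 2\<close>. In the other products of \<open>X\<close>, the minus sign from squaring the
  imaginary unit is absorbed by the oddness of \<open>e\<close>.\<close>

lemma sign_correlation:
  assumes s: "0 < s" "s < int n"
  shows "(\<Sum>k<n. e (int k - s) * e (int k) + d (int k - s) * d (int k)) = 0"
proof -
  obtain m where m: "s = int m" "0 < m" "m < n"
    using s by (metis of_nat_0_less_iff of_nat_less_iff zero_less_imp_eq_int)
  let ?c2 = "complex_of_real (c * c)"
  \<comment> \<open>At \<open>k = 0\<close> and \<open>k = m\<close> the factor
    \<open>e 0 = 0\<close> kills the product of \<open>e\<close>, so the exceptional values
    \<open>X s\<close> are listed separately.\<close>
  have "X (s - int k) * X (int k) + Y (int k - s) * Y (int k) =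
      (if k = 0 then X s else 0) + (if k = m then X s else 0) +
      ?c2 * of_int (e (int k - s) * e (int k) + d (int k - s) * d (int k))" (is "?l = ?r")
    if k: "k < n" for k
  proof (cases "k = 0 \<or> k = m")
    case True
    then show ?thesis
      using m by (auto simp: X_0 e_zero Y_eq algebra_simps)
  next
    case False
    have "\<not> int n dvd int k" using False k by (auto dest: dvd_imp_le)
    moreover have "\<not> int n dvd s - int k"
    proof
      assume "int n dvd s - int k"
      then have "\<bar>int n\<bar> \<le> \<bar>s - int k\<bar>" using False m by (intro dvd_imp_le_int) auto
      then show False using m k by simp
    qed
    ultimately show ?thesis
      using False e_minus[of "s - int k"]
      by (simp add: X_eq Y_eq algebra_simps)
  qed
  then have "(\<Sum>k<n. X (s - int k) * X (int k) + Y (int k - s) * Y (int k)) =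
      (\<Sum>k<n. (if k = 0 then X s else 0) + (if k = m then X s else 0) +
      ?c2 * of_int (e (int k - s) * e (int k) + d (int k - s) * d (int k)))"
    by (intro sum.cong) auto
  also have "\<dots> = 2 * X s +
      ?c2 * of_int (\<Sum>k<n. e (int k - s) * e (int k) + d (int k - s) * d (int k))"
    using m by (simp add: sum.distrib distrib_left sum_distrib_left)
  finally have "?c2 * of_int (\<Sum>k<n. e (int k - s) * e (int k) + d (int k - s) * d (int k)) = 0"
    using frame_correlation[of s] by (simp add: A_eq)
  then show ?thesis using c_pos by (simp del: of_int_sum of_int_add)
qed

end

subsection \<open>Projective representations of the dihedral group\<close>

text \<open>Equality up to a phase, the sense in which \<open>\<pi>\<close> respects the group
  relations.\<close>

definition proportional :: "complex mat \<Rightarrow> complex mat \<Rightarrow> bool" where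
  "proportional M N \<longleftrightarrow> (\<exists>a. cmod a = 1 \<and> M = a \<cdot>\<^sub>m N)"

lemma smult_smult_mat: "a \<cdot>\<^sub>m (b \<cdot>\<^sub>m M) = (a * b :: 'a :: semiring_0) \<cdot>\<^sub>m M"
  by (intro eq_matI) (auto simp: mult.assoc)

lemma one_smult_mat: "(1 :: 'a :: semiring_1) \<cdot>\<^sub>m M = M"
  by (intro eq_matI) auto

lemma proportional_refl: "proportional M M"
  unfolding proportional_def by (rule exI[of _ 1]) (simp add: one_smult_mat)

lemma proportional_sym: "proportional M N \<Longrightarrow> proportional N M"
proof -
  assume "proportional M N"
  then obtain a where a: "cmod a = 1" "M = a \<cdot>\<^sub>m N" by (auto simp: proportional_def)
  then have "a \<noteq> 0" by auto
  then have "N = inverse a \<cdot>\<^sub>m M" unfolding a(2) smult_smult_mat by (simp add: one_smult_mat)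
  moreover have "cmod (inverse a) = 1" using a(1) by (simp add: norm_inverse)
  ultimately show ?thesis unfolding proportional_def by blast
qed

lemma proportional_smult: "cmod a = 1 \<Longrightarrow> proportional M (a \<cdot>\<^sub>m M)"
  by (rule proportional_sym) (auto simp: proportional_def)

lemma proportional_trans [trans]:
  "proportional L M \<Longrightarrow> proportional M N \<Longrightarrow> proportional L N"
  unfolding proportional_def by (metis mult_1 norm_mult smult_smult_mat)

lemma proportional_mult:
  assumes "proportional M M'" "proportional N N'" "M' \<in> carrier_mat n n" "N' \<in> carrier_mat n n"
  shows "proportional (M * N) (M' * N')"
proof -
  obtain a b where ab: "cmod a = 1" "M = a \<cdot>\<^sub>m M'" "cmod b = 1" "N = b \<cdot>\<^sub>m N'"
    using assms by (auto simp: proportional_def)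
  have "M * N = (b * a) \<cdot>\<^sub>m (M' * N')"
    unfolding ab using assms(3,4)
    by (simp add: mult_smult_distrib[of _ n n _ n] mult_smult_assoc_mat[of _ n n _ n] smult_smult_mat)
  then show ?thesis unfolding proportional_def using ab by (metis mult_1 norm_mult)
qed

lemma pow_mat_smult:
  fixes M :: "'a :: comm_ring_1 mat"
  assumes "M \<in> carrier_mat n n"
  shows "(a \<cdot>\<^sub>m M) ^\<^sub>m k = a ^ k \<cdot>\<^sub>m M ^\<^sub>m k"
proof (induction k)
  case (Suc k)
  have "(a \<cdot>\<^sub>m M) ^\<^sub>m Suc k = (a ^ k \<cdot>\<^sub>m M ^\<^sub>m k) * (a \<cdot>\<^sub>m M)" using Suc by simp
  also have "\<dots> = (a * a ^ k) \<cdot>\<^sub>m (M ^\<^sub>m k * M)"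
    using assms mult_smult_distrib[of "a ^ k \<cdot>\<^sub>m M ^\<^sub>m k" n n M n a]
      mult_smult_assoc_mat[of "M ^\<^sub>m k" n n M n "a ^ k"]
    by (simp add: smult_smult_mat)
  finally show ?case by simp
qed (simp add: one_smult_mat)

lemma pow_mat_one: "(1\<^sub>m n :: 'a :: comm_ring_1 mat) ^\<^sub>m k = 1\<^sub>m n"
  by (induction k) auto

lemma pow_mat_mult:
  assumes "M \<in> carrier_mat n n"
  shows "M ^\<^sub>m (k * l) = (M ^\<^sub>m k) ^\<^sub>m l"
proof (induction l)
  case (Suc l)
  have "M ^\<^sub>m (k * Suc l) = M ^\<^sub>m (k * l) * M ^\<^sub>m k"
    using pow_mat_add[OF assms, of "k * l" k] by (simp add: add.commute)
  then show ?case using Suc by simp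
qed (use assms in simp)

lemma unitary_smult:
  assumes "M \<in> unitary_mats n" "cmod a = 1"
  shows "a \<cdot>\<^sub>m M \<in> unitary_mats n"
proof -
  have M: "M \<in> carrier_mat n n" "mat_adjoint M \<in> carrier_mat n n"
    using assms mat_adjoint_carrier by (auto simp: unitary_mats_def)
  have adj: "mat_adjoint (a \<cdot>\<^sub>m M) = cnj a \<cdot>\<^sub>m mat_adjoint M"
    using M mat_adjoint_carrier[of "a \<cdot>\<^sub>m M" n n]
    by (intro eq_matI) (auto simp: index_mat_adjoint[of _ n n])
  have "a * cnj a = 1" using assms(2) by (simp add: complex_norm_square[symmetric])
  then show ?thesis
    using assms M unfolding unitary_mats_def
    by (simp add: adj mult_smult_distrib[of _ n n _ n] mult_smult_assoc_mat[of _ n n _ n]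
        smult_smult_mat one_smult_mat mult.commute)
qed

text \<open>One factor \<open>M\<close> cancels against its adjoint. The intended \<open>M\<close>
  is the image of the neutral element.\<close>

lemma unitary_proportional_idempotent:
  assumes M: "M \<in> unitary_mats n" and "proportional M (M * M)"
  shows "proportional M (1\<^sub>m n)"
proof -
  obtain a where a: "cmod a = 1" "M = a \<cdot>\<^sub>m (M * M)"
    using assms by (auto simp: proportional_def)
  have c: "M \<in> carrier_mat n n" "mat_adjoint M \<in> carrier_mat n n"
    using M mat_adjoint_carrier by (auto simp: unitary_mats_def)
  have "1\<^sub>m n = mat_adjoint M * M" using M by (simp add: unitary_mats_def)
  also have "\<dots> = mat_adjoint M * (a \<cdot>\<^sub>m (M * M))" using a(2) by simp
  also have "\<dots> = a \<cdot>\<^sub>m (mat_adjoint M * (M * M))"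
    using c by (intro mult_smult_distrib[of _ n n _ n]) auto
  also have "mat_adjoint M * (M * M) = (mat_adjoint M * M) * M"
    using c by (intro assoc_mult_mat[symmetric, of _ n n _ n _ n]) auto
  also have "\<dots> = M" using M c(1) by (simp add: unitary_mats_def)
  finally have "proportional (1\<^sub>m n) M" using a(1) by (auto simp: proportional_def)
  then show ?thesis by (rule proportional_sym)
qed

section \<open>Relations between the represented generators\<close>

locale dihedral_rep =
  fixes n :: nat and \<pi> :: "int \<times> bool \<Rightarrow> complex mat"
  assumes n: "n > 0" and rep: "projective_unitary_rep n (dihedral n) \<pi>"
begin

sublocale group "dihedral n" by (rule dihedral_group[OF n])

abbreviation "r \<equiv> rotation n"

lemma r [simp]: "r \<in> carrier (dihedral n)" "reflection \<in> carrier (dihedral n)"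
  using n by (auto simp: dihedral_def rotation_def reflection_def)

lemma unitary: "g \<in> carrier (dihedral n) \<Longrightarrow> \<pi> g \<in> unitary_mats n"
  using rep by (simp add: projective_unitary_rep_def)

lemma carrier_rep [simp]: "g \<in> carrier (dihedral n) \<Longrightarrow> \<pi> g \<in> carrier_mat n n"
  using unitary by (auto simp: unitary_mats_def)

lemma rep_mult:
  assumes "g \<in> carrier (dihedral n)" "h \<in> carrier (dihedral n)"
  shows "proportional (\<pi> (g \<otimes>\<^bsub>dihedral n\<^esub> h)) (\<pi> g * \<pi> h)"
  using rep assms by (simp add: projective_unitary_rep_def proportional_def)

lemma rep_one: "proportional (\<pi> \<one>\<^bsub>dihedral n\<^esub>) (1\<^sub>m n)"
  using rep_mult[of "\<one>\<^bsub>dihedral n\<^esub>" "\<one>\<^bsub>dihedral n\<^esub>"] unitary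
  by (intro unitary_proportional_idempotent) auto

lemma rep_rotation_pow: "proportional (\<pi> (r [^]\<^bsub>dihedral n\<^esub> k)) (\<pi> r ^\<^sub>m k)"
proof (induction k)
  case 0
  show ?case using rep_one carrier_matD[OF carrier_rep[OF r(1)]] by simp
next
  case (Suc k)
  have "proportional (\<pi> (r [^]\<^bsub>dihedral n\<^esub> Suc k)) (\<pi> (r [^]\<^bsub>dihedral n\<^esub> k) * \<pi> r)"
    using rep_mult[of "r [^]\<^bsub>dihedral n\<^esub> k" r] by simp
  also have "proportional \<dots> (\<pi> r ^\<^sub>m k * \<pi> r)"
    using Suc by (intro proportional_mult[of _ _ _ _ n]) (auto simp: proportional_refl)
  finally show ?case by simp
qed

lemma rep_rotation_pow_reflection:
  "proportional (\<pi> (r [^]\<^bsub>dihedral n\<^esub> k \<otimes>\<^bsub>dihedral n\<^esub> reflection)) (\<pi> r ^\<^sub>m k * \<pi> reflection)"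
proof -
  have "proportional (\<pi> (r [^]\<^bsub>dihedral n\<^esub> k \<otimes>\<^bsub>dihedral n\<^esub> reflection))
      (\<pi> (r [^]\<^bsub>dihedral n\<^esub> k) * \<pi> reflection)"
    by (rule rep_mult) auto
  also have "proportional \<dots> (\<pi> r ^\<^sub>m k * \<pi> reflection)"
    using rep_rotation_pow by (intro proportional_mult[of _ _ _ _ n]) (auto simp: proportional_refl)
  finally show ?thesis .
qed

lemma rotation_pow_n: "proportional (\<pi> r ^\<^sub>m n) (1\<^sub>m n)"
proof -
  have "proportional (\<pi> r ^\<^sub>m n) (\<pi> \<one>\<^bsub>dihedral n\<^esub>)"
    using proportional_sym[OF rep_rotation_pow[of n]] dihedral_relations(1)[OF n] by simp
  then show ?thesis using rep_one by (rule proportional_trans)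
qed

lemma reflection_square: "proportional (\<pi> reflection * \<pi> reflection) (1\<^sub>m n)"
proof -
  have "proportional (\<pi> reflection * \<pi> reflection) (\<pi> \<one>\<^bsub>dihedral n\<^esub>)"
    using proportional_sym[OF rep_mult[of reflection reflection]] dihedral_relations(2)[OF n] by simp
  then show ?thesis using rep_one by (rule proportional_trans)
qed

text \<open>The inverse rotation appears as the power \<open>n - 1\<close>, so that only natural
  matrix powers occur.\<close>

lemma reflection_rotation:
  "proportional (\<pi> reflection * \<pi> r) (\<pi> r ^\<^sub>m (n - 1) * \<pi> reflection)"
proof -
  have "r [^]\<^bsub>dihedral n\<^esub> (n - 1) \<otimes>\<^bsub>dihedral n\<^esub> r = \<one>\<^bsub>dihedral n\<^esub>"
    using dihedral_relations(1)[OF n] n by (metis One_nat_def Suc_pred nat_pow_Suc)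
  then have "inv\<^bsub>dihedral n\<^esub> r = r [^]\<^bsub>dihedral n\<^esub> (n - 1)"
    by (rule inv_equality) auto
  then have "proportional (\<pi> reflection * \<pi> r)
      (\<pi> (r [^]\<^bsub>dihedral n\<^esub> (n - 1) \<otimes>\<^bsub>dihedral n\<^esub> reflection))"
    using proportional_sym[OF rep_mult[of reflection r]] dihedral_relations(3)[OF n] by simp
  then show ?thesis using rep_rotation_pow_reflection by (rule proportional_trans)
qed

text \<open>Square roots of phases make the relations exact: \<open>b\<close> normalises the square
  of the reflection, \<open>a\<close> the conjugation relation. Conjugation by the reflection then
  forces the square of the leftover scalar \<open>\<gamma>\<close> to be 1.\<close>

lemma normalized_generators:
  obtains a b \<gamma> where "cmod a = 1" "cmod b = 1" "\<gamma> * \<gamma> = 1"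
    "(a \<cdot>\<^sub>m \<pi> r) ^\<^sub>m n = \<gamma> \<cdot>\<^sub>m 1\<^sub>m n"
    "(b \<cdot>\<^sub>m \<pi> reflection) * (a \<cdot>\<^sub>m \<pi> r) = (a \<cdot>\<^sub>m \<pi> r) ^\<^sub>m (2 * n - 1) * (b \<cdot>\<^sub>m \<pi> reflection)"
    "(b \<cdot>\<^sub>m \<pi> reflection) * (b \<cdot>\<^sub>m \<pi> reflection) = 1\<^sub>m n"
proof -
  define R F where "R = \<pi> r" and "F = \<pi> reflection"
  have RF: "R \<in> carrier_mat n n" "F \<in> carrier_mat n n" by (simp_all add: R_def F_def)
  obtain \<alpha> \<beta> \<kappa> where \<alpha>: "cmod \<alpha> = 1" "R ^\<^sub>m n = \<alpha> \<cdot>\<^sub>m 1\<^sub>m n"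
    and \<beta>: "cmod \<beta> = 1" "F * F = \<beta> \<cdot>\<^sub>m 1\<^sub>m n"
    and \<kappa>: "cmod \<kappa> = 1" "F * R = \<kappa> \<cdot>\<^sub>m (R ^\<^sub>m (n - 1) * F)"
    using rotation_pow_n reflection_square reflection_rotation
    unfolding proportional_def R_def F_def by blast
  have nz: "\<alpha> \<noteq> 0" "\<beta> \<noteq> 0" "\<kappa> \<noteq> 0" using \<alpha> \<beta> \<kappa> by auto
  \<comment> \<open>Conjugation by \<open>F\<close> sends \<open>R\<close> to
    \<open>\<kappa> * \<alpha>\<close> times its inverse, since the power \<open>n - 1\<close> of
    \<open>R\<close> is \<open>\<alpha>\<close> times that inverse. Scaling \<open>R\<close> by
    \<open>a\<close> multiplies this phase by \<open>a * a\<close>.\<close>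
  define a where "a = csqrt (inverse (\<kappa> * \<alpha>))"
  define b where "b = csqrt (inverse \<beta>)"
  have a2: "a * a * (\<kappa> * \<alpha>) = 1" and b2: "b * b * \<beta> = 1"
    using nz by (auto simp: a_def b_def power2_eq_square[symmetric] field_simps)
  have "cmod a = 1" "cmod b = 1"
    unfolding a_def b_def using \<alpha> \<beta> \<kappa> by (auto simp: norm_mult norm_inverse)
  have anz: "a \<noteq> 0" "b \<noteq> 0" using \<open>cmod a = 1\<close> \<open>cmod b = 1\<close> by auto
  define U T where "U = a \<cdot>\<^sub>m R" and "T = b \<cdot>\<^sub>m F"
  have UT: "U \<in> carrier_mat n n" "T \<in> carrier_mat n n" using RF by (auto simp: U_def T_def)
  have pow_carrier: "M ^\<^sub>m k \<in> carrier_mat n n" if "M \<in> carrier_mat n n" for k and M :: "complex mat"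
    using that by simp
  define \<gamma> where "\<gamma> = a ^ n * \<alpha>"
  have gnz: "\<gamma> \<noteq> 0" using anz nz by (simp add: \<gamma>_def)
  have Un: "U ^\<^sub>m n = \<gamma> \<cdot>\<^sub>m 1\<^sub>m n"
    unfolding U_def pow_mat_smult[OF RF(1)] \<alpha> smult_smult_mat \<gamma>_def ..
  have TT: "T * T = 1\<^sub>m n"
  proof -
    have "T * T = (b * b) \<cdot>\<^sub>m (F * F)"
      unfolding T_def using RF mult_smult_distrib[of "b \<cdot>\<^sub>m F" n n F n b]
        mult_smult_assoc_mat[of F n n F n b] by (simp add: smult_smult_mat)
    then show ?thesis unfolding \<beta> smult_smult_mat b2 one_smult_mat .
  qed
  \<comment> \<open>\<open>W\<close> is the inverse of \<open>U\<close>, because the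
    \<open>n\<close>-th power of \<open>U\<close> is the scalar \<open>\<gamma>\<close>.\<close>
  define W where "W = inverse \<gamma> \<cdot>\<^sub>m U ^\<^sub>m (n - 1)"
  have W: "W \<in> carrier_mat n n" using UT by (simp add: W_def)
  have TU: "T * U = W * T"
  proof -
    have "T * U = (a * b) \<cdot>\<^sub>m (F * R)"
      unfolding T_def U_def using RF mult_smult_distrib[of "b \<cdot>\<^sub>m F" n n R n a]
        mult_smult_assoc_mat[of F n n R n b] by (simp add: smult_smult_mat)
    also have "\<dots> = (a * b * \<kappa>) \<cdot>\<^sub>m (R ^\<^sub>m (n - 1) * F)"
      unfolding \<kappa> smult_smult_mat ..
    also have "a * b * \<kappa> = b * (inverse \<gamma> * a ^ (n - 1))"
    proof -
      have "a ^ n = a * a ^ (n - 1)" using n by (simp add: power_eq_if)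
      then have "b * (inverse \<gamma> * a ^ (n - 1)) = b * inverse (a * \<alpha>)"
        using anz nz by (simp add: \<gamma>_def field_simps)
      moreover have "a * \<kappa> = inverse (a * \<alpha>)"
        using a2 anz nz by (simp add: field_simps)
      ultimately show ?thesis by (metis mult.assoc mult.commute)
    qed
    also have "(b * (inverse \<gamma> * a ^ (n - 1))) \<cdot>\<^sub>m (R ^\<^sub>m (n - 1) * F) = W * T"
      unfolding W_def T_def U_def pow_mat_smult[OF RF(1)] smult_smult_mat
      using RF pow_carrier[OF RF(1), of "n - 1"]
        mult_smult_distrib[of "(inverse \<gamma> * a ^ (n - 1)) \<cdot>\<^sub>m R ^\<^sub>m (n - 1)" n n F n b]
        mult_smult_assoc_mat[of "R ^\<^sub>m (n - 1)" n n F n "inverse \<gamma> * a ^ (n - 1)"]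
      by (simp add: smult_smult_mat)
    finally show ?thesis .
  qed
  have TU_pow: "T * U ^\<^sub>m k = W ^\<^sub>m k * T" for k
  proof (induction k)
    case 0
    show ?case using UT W by simp
  next
    case (Suc k)
    have "T * U ^\<^sub>m Suc k = (T * U ^\<^sub>m k) * U"
      using UT by (simp add: assoc_mult_mat[of _ n n _ n _ n])
    also have "\<dots> = W ^\<^sub>m k * (T * U)"
      unfolding Suc using UT W by (intro assoc_mult_mat[of _ n n _ n _ n]) auto
    also have "\<dots> = W ^\<^sub>m Suc k * T"
      unfolding TU using UT W by (simp add: assoc_mult_mat[of _ n n _ n _ n])
    finally show ?case .
  qed
  have Wn: "W ^\<^sub>m n = inverse \<gamma> \<cdot>\<^sub>m 1\<^sub>m n"
  proof -
    have "W ^\<^sub>m n = inverse \<gamma> ^ n \<cdot>\<^sub>m U ^\<^sub>m ((n - 1) * n)"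
      unfolding W_def pow_mat_smult[OF pow_carrier[OF UT(1)]] pow_mat_mult[OF UT(1)] ..
    also have "U ^\<^sub>m ((n - 1) * n) = \<gamma> ^ (n - 1) \<cdot>\<^sub>m 1\<^sub>m n"
      unfolding mult.commute[of "n - 1"] pow_mat_mult[OF UT(1)] Un
        pow_mat_smult[OF one_carrier_mat] pow_mat_one ..
    also have "inverse \<gamma> ^ n \<cdot>\<^sub>m (\<gamma> ^ (n - 1) \<cdot>\<^sub>m 1\<^sub>m n) = inverse \<gamma> \<cdot>\<^sub>m (1\<^sub>m n :: complex mat)"
      unfolding smult_smult_mat using gnz n by (simp add: power_eq_if[of _ n] power_inverse field_simps)
    finally show ?thesis .
  qed
  \<comment> \<open>Conjugation by \<open>T\<close> fixes the scalar \<open>U ^\<^sub>m n\<close>,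
    yet sends it to \<open>W ^\<^sub>m n\<close>, its inverse.\<close>
  have g2: "\<gamma> * \<gamma> = 1"
  proof -
    have "\<gamma> \<cdot>\<^sub>m T = T * U ^\<^sub>m n"
      unfolding Un using UT by (simp add: mult_smult_distrib[of _ n n _ n])
    also have "\<dots> = inverse \<gamma> \<cdot>\<^sub>m T"
      unfolding TU_pow Wn using UT by (simp add: mult_smult_assoc_mat[of _ n n _ n])
    finally have "(\<gamma> \<cdot>\<^sub>m T) * T = (inverse \<gamma> \<cdot>\<^sub>m T) * T" by simp
    then have "\<gamma> \<cdot>\<^sub>m (1\<^sub>m n :: complex mat) = inverse \<gamma> \<cdot>\<^sub>m 1\<^sub>m n"
      using UT TT by (simp add: mult_smult_assoc_mat[of _ n n _ n])
    then have "(\<gamma> \<cdot>\<^sub>m (1\<^sub>m n :: complex mat)) $$ (0, 0) = (inverse \<gamma> \<cdot>\<^sub>m 1\<^sub>m n) $$ (0, 0)" by simp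
    then have "\<gamma> = inverse \<gamma>" using n by simp
    then show ?thesis using gnz by (metis right_inverse)
  qed
  have "W = U ^\<^sub>m (2 * n - 1)"
  proof -
    have "2 * n - 1 = n + (n - 1)" using n by simp
    then have "U ^\<^sub>m (2 * n - 1) = U ^\<^sub>m n * U ^\<^sub>m (n - 1)"
      using pow_mat_add[OF UT(1)] by simp
    also have "\<dots> = \<gamma> \<cdot>\<^sub>m U ^\<^sub>m (n - 1)"
      unfolding Un using UT by (simp add: mult_smult_assoc_mat[of _ n n _ n])
    also have "\<gamma> = inverse \<gamma>" using g2 gnz by (metis inverse_unique)
    finally show ?thesis by (simp add: W_def)
  qed
  then show ?thesis
    using that[of a b \<gamma>] \<open>cmod a = 1\<close> \<open>cmod b = 1\<close> g2 Un TU TT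
    by (simp add: U_def T_def R_def F_def)
qed

end

text \<open>\<open>U ^\<^sub>m k\<close> sends each basis vector to a multiple of the one
  \<open>k\<close> places further on cyclically, hence of a different one. The phases
  \<open>a\<close> allow \<open>ws\<close> to be built from \<open>\<pi>\<close> instead of
  \<open>U\<close>.\<close>

lemma regular_trace_zero:
  assumes n: "n > 0" and U: "U \<in> carrier_mat n n" and v: "v \<in> carrier_vec n"
    and Un: "U ^\<^sub>m n = \<gamma> \<cdot>\<^sub>m 1\<^sub>m n"
    and orbit: "\<And>m. m < n \<Longrightarrow> cmod (a m) = 1 \<and> ws ! m = a m \<cdot>\<^sub>v (U ^\<^sub>m m *\<^sub>v v)"
    and len: "length ws = n" and "distinct ws"
    and "vectorspace.basis class_ring (module_vec TYPE(complex) n) (set ws)"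
    and k: "0 < k" "k < n"
  shows "mat_trace (U ^\<^sub>m k) = 0"
proof (rule mat_trace_permuted_basis)
  interpret vec_space "TYPE(complex)" n .
  show "det (mat_of_cols n ws) \<noteq> 0"
    using assms by (intro det_nonzero_if_basis) auto
  show "U ^\<^sub>m k \<in> carrier_mat n n" using U by simp
  show "mat_of_cols n ws \<in> carrier_mat n n" using len by (metis mat_of_cols_carrier(1))
  fix m assume m: "m < n"
  have dim: "ws ! m \<in> carrier_vec n" if "m < n" for m
    using orbit[OF that] U v by (auto intro!: mult_mat_vec_carrier)
  have col: "col (mat_of_cols n ws) m = ws ! m" if "m < n" for m
    using dim[OF that] that len by simp
  define j where "j = (m + k) mod n"
  \<comment> \<open>The factor is 1 without wrap-around and \<open>\<gamma>\<close> when the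
    exponent passes \<open>n\<close>.\<close>
  obtain c where c: "U ^\<^sub>m (k + m) = c \<cdot>\<^sub>m U ^\<^sub>m j"
  proof (cases "m + k < n")
    case True
    then show ?thesis using that[of 1] by (simp add: j_def one_smult_mat add.commute)
  next
    case False
    then have "j = m + k - n" using m k by (simp add: j_def mod_if)
    then have "k + m = n + j" using False by simp
    then have "U ^\<^sub>m (k + m) = \<gamma> \<cdot>\<^sub>m U ^\<^sub>m j"
      using pow_mat_add[OF U, of n j] U
      by (simp add: Un mult_smult_assoc_mat[of "1\<^sub>m n" n n "U ^\<^sub>m j" n \<gamma>])
    then show ?thesis by (rule that)
  qed
  have j: "j < n" "j \<noteq> m" using m k by (auto simp: j_def mod_if)
  have "a j \<noteq> 0" using orbit[OF j(1)] by auto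
  have "U ^\<^sub>m k *\<^sub>v ws ! m = a m \<cdot>\<^sub>v (U ^\<^sub>m k *\<^sub>v (U ^\<^sub>m m *\<^sub>v v))"
    using orbit[OF m] U v mult_mat_vec[of "U ^\<^sub>m k" n n "U ^\<^sub>m m *\<^sub>v v" "a m"]
      mult_mat_vec_carrier[of "U ^\<^sub>m m" n n v] by simp
  also have "U ^\<^sub>m k *\<^sub>v (U ^\<^sub>m m *\<^sub>v v) = U ^\<^sub>m (k + m) *\<^sub>v v"
    unfolding pow_mat_add[OF U] using U v by (intro assoc_mult_mat_vec[symmetric, of _ n n _ n]) auto
  also have "\<dots> = c \<cdot>\<^sub>v (U ^\<^sub>m j *\<^sub>v v)"
    unfolding c using U v by (intro eq_vecI) auto
  also have "a m \<cdot>\<^sub>v \<dots> = (a m * c / a j) \<cdot>\<^sub>v ws ! j"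
    using orbit[OF j(1)] \<open>a j \<noteq> 0\<close> by (simp add: smult_smult_assoc)
  finally show "\<exists>j c. j < n \<and> j \<noteq> m \<and>
      U ^\<^sub>m k *\<^sub>v col (mat_of_cols n ws) m = c \<cdot>\<^sub>v col (mat_of_cols n ws) j"
    using j m col by (intro exI[of _ j] exI[of _ "a m * c / a j"]) simp
qed

section \<open>From a regular configuration to the normalised frame\<close>

lemma smult_smult_cscalar_prod:
  fixes a :: complex
  assumes "cmod a = 1" "w \<in> carrier_vec n" "x \<in> carrier_vec n" "y \<in> carrier_vec n"
  shows "(x \<bullet>c (a \<cdot>\<^sub>v w)) * ((a \<cdot>\<^sub>v w) \<bullet>c y) = (x \<bullet>c w) * (w \<bullet>c y)"
proof -
  have "cnj a * a = 1" using assms(1) by (simp add: complex_norm_square[symmetric] mult.commute)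
  moreover have "(x \<bullet>c (a \<cdot>\<^sub>v w)) * ((a \<cdot>\<^sub>v w) \<bullet>c y) = (cnj a * a) * ((x \<bullet>c w) * (w \<bullet>c y))"
    using assms by (simp add: conjugate_smult_vec)
  ultimately show ?thesis by simp
qed

text \<open>Each frame vector is a phase times a power of \<open>U\<close> applied to
  \<open>v\<close> or \<open>T *\<^sub>v v\<close>. The frame identity, the moduli and the basis
  property do not see such phases.\<close>

lemma dihedral_frame_exists:
  assumes pos: "n > 0" and even: "even n" and conf: "regular_dihedral_configuration n \<phi>"
    and etf: "ETF (2 * n) n (carrier (dihedral n)) \<phi>"
  shows "\<exists>U T v \<gamma> A c. dihedral_frame n U T v \<gamma> A c"
proof -
  obtain \<pi> v where rep: "projective_unitary_rep n (dihedral n) \<pi>" and v: "unit_vector n v"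
    and reg: "regular n \<pi> v" and \<phi>: "\<And>g. g \<in> carrier (dihedral n) \<Longrightarrow> \<phi> g = \<pi> g *\<^sub>v v"
    using conf by (auto simp: regular_dihedral_configuration_def)
  interpret dihedral_rep n \<pi> using pos rep by unfold_locales
  have vn: "v \<in> carrier_vec n" "v \<bullet>c v = 1" using v by (auto simp: unit_vector_def)
  obtain a b \<gamma> where ab: "cmod a = 1" "cmod b = 1" and \<gamma>: "\<gamma> * \<gamma> = 1"
    and Un: "(a \<cdot>\<^sub>m \<pi> r) ^\<^sub>m n = \<gamma> \<cdot>\<^sub>m 1\<^sub>m n"
    and TU: "(b \<cdot>\<^sub>m \<pi> reflection) * (a \<cdot>\<^sub>m \<pi> r) =
      (a \<cdot>\<^sub>m \<pi> r) ^\<^sub>m (2 * n - 1) * (b \<cdot>\<^sub>m \<pi> reflection)"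
    and TT: "(b \<cdot>\<^sub>m \<pi> reflection) * (b \<cdot>\<^sub>m \<pi> reflection) = 1\<^sub>m n"
    by (rule normalized_generators)
  define U T where "U = a \<cdot>\<^sub>m \<pi> r" and "T = b \<cdot>\<^sub>m \<pi> reflection"
  have UT: "U \<in> unitary_mats n" "T \<in> unitary_mats n"
    using ab unitary[OF r(1)] unitary[OF r(2)] by (auto simp: U_def T_def intro!: unitary_smult)
  then have UTc: "U \<in> carrier_mat n n" "T \<in> carrier_mat n n" by (auto simp: unitary_mats_def)
  have Uk: "U ^\<^sub>m k \<in> carrier_mat n n" for k using UTc by simp
  have Tv: "T *\<^sub>v v \<in> carrier_vec n" using UTc vn by (auto intro!: mult_mat_vec_carrier)
  have U\<pi>: "proportional (\<pi> r ^\<^sub>m k) (U ^\<^sub>m k)" for k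
    unfolding U_def pow_mat_smult[OF carrier_rep[OF r(1)]]
    by (rule proportional_smult) (simp add: norm_power ab)
  have T\<pi>: "proportional (\<pi> reflection) T"
    unfolding T_def using ab(2) by (rule proportional_smult)
  have rot: "\<exists>c. cmod c = 1 \<and> \<pi> (r [^]\<^bsub>dihedral n\<^esub> k) *\<^sub>v v = c \<cdot>\<^sub>v (U ^\<^sub>m k *\<^sub>v v)" for k
  proof -
    have "proportional (\<pi> (r [^]\<^bsub>dihedral n\<^esub> k)) (U ^\<^sub>m k)"
      using rep_rotation_pow U\<pi> by (rule proportional_trans)
    then obtain c where "cmod c = 1" "\<pi> (r [^]\<^bsub>dihedral n\<^esub> k) = c \<cdot>\<^sub>m U ^\<^sub>m k"
      by (auto simp: proportional_def)
    then show ?thesis using Uk[of k] vn by (intro exI[of _ c] conjI eq_vecI) auto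
  qed
  have reflected: "\<exists>c. cmod c = 1 \<and> \<pi> (r [^]\<^bsub>dihedral n\<^esub> k \<otimes>\<^bsub>dihedral n\<^esub> reflection) *\<^sub>v v =
      c \<cdot>\<^sub>v (U ^\<^sub>m k *\<^sub>v (T *\<^sub>v v))" for k
  proof -
    have "proportional (\<pi> r ^\<^sub>m k * \<pi> reflection) (U ^\<^sub>m k * T)"
      using U\<pi> T\<pi> Uk UTc by (intro proportional_mult) auto
    with rep_rotation_pow_reflection
    have "proportional (\<pi> (r [^]\<^bsub>dihedral n\<^esub> k \<otimes>\<^bsub>dihedral n\<^esub> reflection)) (U ^\<^sub>m k * T)"
      by (rule proportional_trans)
    then obtain c where c: "cmod c = 1"
      "\<pi> (r [^]\<^bsub>dihedral n\<^esub> k \<otimes>\<^bsub>dihedral n\<^esub> reflection) = c \<cdot>\<^sub>m (U ^\<^sub>m k * T)"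
      by (auto simp: proportional_def)
    have "(c \<cdot>\<^sub>m (U ^\<^sub>m k * T)) *\<^sub>v v = c \<cdot>\<^sub>v ((U ^\<^sub>m k * T) *\<^sub>v v)"
      using Uk[of k] UTc vn by (intro eq_vecI) auto
    then show ?thesis
      using c Uk[of k] UTc vn by (auto simp: assoc_mult_mat_vec[of _ n n _ n])
  qed
  have elem: "(int k, False) = r [^]\<^bsub>dihedral n\<^esub> k"
    "(int k, True) = r [^]\<^bsub>dihedral n\<^esub> k \<otimes>\<^bsub>dihedral n\<^esub> reflection" if "k < n" for k
    unfolding rotation_pow using that by (auto simp: dihedral_def reflection_def)
  have carrier: "carrier (dihedral n) = (\<lambda>k. (int k, False)) ` {..<n} \<union> (\<lambda>k. (int k, True)) ` {..<n}"
  proof -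
    have "{0..<int n} = int ` {..<n}"
      by (simp add: image_int_atLeastLessThan lessThan_atLeast0)
    then show ?thesis by (auto simp: dihedral_def)
  qed
  obtain \<alpha> \<beta> where \<alpha>: "\<And>k. cmod (\<alpha> k) = 1"
      "\<And>k. k < n \<Longrightarrow> \<phi> (int k, False) = \<alpha> k \<cdot>\<^sub>v (U ^\<^sub>m k *\<^sub>v v)"
    and \<beta>: "\<And>k. cmod (\<beta> k) = 1"
      "\<And>k. k < n \<Longrightarrow> \<phi> (int k, True) = \<beta> k \<cdot>\<^sub>v (U ^\<^sub>m k *\<^sub>v (T *\<^sub>v v))"
  proof -
    obtain \<alpha> where "\<And>k. cmod (\<alpha> k) = 1 \<and>
        \<pi> (r [^]\<^bsub>dihedral n\<^esub> k) *\<^sub>v v = \<alpha> k \<cdot>\<^sub>v (U ^\<^sub>m k *\<^sub>v v)"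
      using rot by metis
    moreover obtain \<beta> where "\<And>k. cmod (\<beta> k) = 1 \<and>
        \<pi> (r [^]\<^bsub>dihedral n\<^esub> k \<otimes>\<^bsub>dihedral n\<^esub> reflection) *\<^sub>v v =
        \<beta> k \<cdot>\<^sub>v (U ^\<^sub>m k *\<^sub>v (T *\<^sub>v v))"
      using reflected by metis
    ultimately show ?thesis
      using that[of \<alpha> \<beta>] elem \<phi> by simp
  qed
  have Ukv: "U ^\<^sub>m k *\<^sub>v v \<in> carrier_vec n" "U ^\<^sub>m k *\<^sub>v (T *\<^sub>v v) \<in> carrier_vec n" for k
    using mult_mat_vec_carrier[OF Uk vn(1)] mult_mat_vec_carrier[OF Uk Tv] by auto
  have tight: "tight_frame n (carrier (dihedral n)) \<phi>" using etf by (simp add: ETF_def)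
  then have dim: "\<And>g. g \<in> carrier (dihedral n) \<Longrightarrow> \<phi> g \<in> carrier_vec n"
    unfolding tight_frame_def by (elim conjE) (rule bspec)
  have "\<exists>A::real. A > 0 \<and> (\<forall>x\<in>carrier_vec n.
      complex_of_real (\<Sum>g\<in>carrier (dihedral n). (cmod (x \<bullet>c \<phi> g))\<^sup>2) = complex_of_real A * (x \<bullet>c x))"
    using tight unfolding tight_frame_def by (elim conjE)
  then obtain A :: real where "A > 0 \<and> (\<forall>x\<in>carrier_vec n.
      complex_of_real (\<Sum>g\<in>carrier (dihedral n). (cmod (x \<bullet>c \<phi> g))\<^sup>2) = complex_of_real A * (x \<bullet>c x))" ..
  then have A: "complex_of_real (\<Sum>g\<in>carrier (dihedral n). (cmod (x \<bullet>c \<phi> g))\<^sup>2) =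
      complex_of_real A * (x \<bullet>c x)" if "x \<in> carrier_vec n" for x
    using that by (elim conjE) (rule bspec)
  have "\<exists>c. \<forall>g\<in>carrier (dihedral n). \<forall>h\<in>carrier (dihedral n). g \<noteq> h \<longrightarrow> cmod (\<phi> g \<bullet>c \<phi> h) = c"
    using etf unfolding ETF_def by (elim conjE)
  then obtain c where
    "\<forall>g\<in>carrier (dihedral n). \<forall>h\<in>carrier (dihedral n). g \<noteq> h \<longrightarrow> cmod (\<phi> g \<bullet>c \<phi> h) = c" ..
  then have c: "\<And>g h. g \<in> carrier (dihedral n) \<Longrightarrow> h \<in> carrier (dihedral n) \<Longrightarrow> g \<noteq> h \<Longrightarrow>
      cmod (\<phi> g \<bullet>c \<phi> h) = c"
    by metis
  have frame: "(\<Sum>k<n. (x \<bullet>c (U ^\<^sub>m k *\<^sub>v v)) * ((U ^\<^sub>m k *\<^sub>v v) \<bullet>c y)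
        + (x \<bullet>c (U ^\<^sub>m k *\<^sub>v (T *\<^sub>v v))) * ((U ^\<^sub>m k *\<^sub>v (T *\<^sub>v v)) \<bullet>c y)) = of_real A * (x \<bullet>c y)"
    if x: "x \<in> carrier_vec n" and y: "y \<in> carrier_vec n" for x y
  proof -
    let ?f = "\<lambda>g. (x \<bullet>c \<phi> g) * (\<phi> g \<bullet>c y)"
    have "of_real A * (x \<bullet>c y) = (\<Sum>g\<in>carrier (dihedral n). ?f g)"
    proof (rule tight_frame_polarization[symmetric, OF dim _ x y])
      fix z :: "complex vec"
      assume "z \<in> carrier_vec n"
      then show "(\<Sum>g\<in>carrier (dihedral n). complex_of_real ((cmod (z \<bullet>c \<phi> g))\<^sup>2)) =
          of_real A * (z \<bullet>c z)"
        using A[of z] by simp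
    qed
    also have "\<dots> = (\<Sum>k<n. ?f (int k, False)) + (\<Sum>k<n. ?f (int k, True))"
      unfolding carrier by (subst sum.union_disjoint) (auto simp: sum.reindex inj_on_def)
    also have "\<dots> = (\<Sum>k<n. (x \<bullet>c (U ^\<^sub>m k *\<^sub>v v)) * ((U ^\<^sub>m k *\<^sub>v v) \<bullet>c y)
        + (x \<bullet>c (U ^\<^sub>m k *\<^sub>v (T *\<^sub>v v))) * ((U ^\<^sub>m k *\<^sub>v (T *\<^sub>v v)) \<bullet>c y))"
      unfolding sum.distrib[symmetric]
    proof (rule sum.cong[OF refl])
      fix k
      assume "k \<in> {..<n}"
      then have k: "k < n" by simp
      show "?f (int k, False) + ?f (int k, True) =
          (x \<bullet>c (U ^\<^sub>m k *\<^sub>v v)) * ((U ^\<^sub>m k *\<^sub>v v) \<bullet>c y)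
          + (x \<bullet>c (U ^\<^sub>m k *\<^sub>v (T *\<^sub>v v))) * ((U ^\<^sub>m k *\<^sub>v (T *\<^sub>v v)) \<bullet>c y)"
        unfolding \<alpha>(2)[OF k] \<beta>(2)[OF k] smult_smult_cscalar_prod[OF \<alpha>(1) Ukv(1) x y]
          smult_smult_cscalar_prod[OF \<beta>(1) Ukv(2) x y] ..
    qed
    finally show ?thesis ..
  qed
  have norm_phase: "cmod ((p \<cdot>\<^sub>v w) \<bullet>c (q \<cdot>\<^sub>v v)) = cmod (w \<bullet>c v)"
    if "cmod p = 1" "cmod q = 1" "w \<in> carrier_vec n" for p q w
    using that vn by (simp add: conjugate_smult_vec norm_mult)
  \<comment> \<open>The moduli are read off against the neutral element, whose frame vector is
    itself only a phase times \<open>v\<close>.\<close>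
  have \<phi>0: "\<phi> (0, False) = \<alpha> 0 \<cdot>\<^sub>v v"
    using \<alpha>(2)[of 0] pos UTc vn by simp
  have in_carrier: "(int k, s) \<in> carrier (dihedral n)" if "k < n" for k s
    using that by (auto simp: dihedral_def)
  let ?ws = "v # map (\<lambda>k. \<pi> (rotation n [^]\<^bsub>dihedral n\<^esub> k) *\<^sub>v v) [1..<n]"
  \<comment> \<open>The list starts with \<open>v\<close> itself, so its phase at 0 is 1 and not
    \<open>\<alpha> 0\<close>.\<close>
  have ws: "?ws ! m = (if m = 0 then 1 else \<alpha> m) \<cdot>\<^sub>v (U ^\<^sub>m m *\<^sub>v v)" if m: "m < n" for m
  proof (cases m)
    case 0
    then show ?thesis using UTc vn by simp
  next
    case (Suc k)
    have "[1..<n] ! k = m" using Suc m by (subst nth_upt) auto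
    then have "?ws ! m = \<pi> (r [^]\<^bsub>dihedral n\<^esub> m) *\<^sub>v v"
      using nth_map[of k "[1..<n]" "\<lambda>k. \<pi> (r [^]\<^bsub>dihedral n\<^esub> k) *\<^sub>v v"] Suc m
      by (simp only: nth_Cons_Suc length_upt)
    then have "?ws ! m = \<phi> (int m, False)"
      unfolding \<phi>[OF in_carrier[OF m]] elem(1)[OF m, symmetric] .
    then show ?thesis using Suc \<alpha>(2)[OF m] by simp
  qed
  have "dihedral_frame n U T v \<gamma> A c"
  proof
    show "cmod ((U ^\<^sub>m k *\<^sub>v v) \<bullet>c v) = c" if "0 < k" "k < n" for k
      using c[OF in_carrier[of k False] in_carrier[of 0 False]] that pos
        norm_phase[OF \<alpha>(1) \<alpha>(1) Ukv(1)] \<alpha>(2)[of k] \<phi>0 by simp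
    show "cmod ((U ^\<^sub>m k *\<^sub>v (T *\<^sub>v v)) \<bullet>c v) = c" if "k < n" for k
      using c[OF in_carrier[of k True] in_carrier[of 0 False]] that pos
        norm_phase[OF \<beta>(1) \<alpha>(1) Ukv(2)] \<beta>(2)[of k] \<phi>0 by simp
    show "mat_trace (U ^\<^sub>m k) = 0" if "0 < k" "k < n" for k
      using reg pos that Un
      by (intro regular_trace_zero[where v = v and ws = ?ws and \<gamma> = \<gamma> and n = n
            and a = "\<lambda>m. if m = 0 then 1 else \<alpha> m"] UTc vn ws conjI)
        (auto simp: regular_def Let_def \<alpha> U_def)
  qed (fact pos even UT \<gamma> Un[folded U_def] TU[folded U_def T_def] TT[folded T_def] vn | (rule frame, assumption, assumption))+
  then show ?thesis by blast
qed

subsection \<open>Negacyclic sign sequences of period 18\<close>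

type_synonym triple = "int \<times> int \<times> int"

text \<open>
  A negacyclic sequence \<open>f\<close> of period 18 is cut into the six triples
  \<open>(f k, - f (k + 6), f (k + 12))\<close>, \<open>k < 6\<close>.  With these signs the index shift by 6 is the cyclic
  \<open>rot\<close> followed by negation, and the total of the triple is the reduction modulo \<open>x\<^sup>6 + 1\<close>.
\<close>

fun dot :: "triple \<Rightarrow> triple \<Rightarrow> int" where
  "dot (p, q, r) (p', q', r') = p * p' + q * q' + r * r'"

fun rot :: "triple \<Rightarrow> triple" where
  "rot (p, q, r) = (q, r, p)"

fun flip :: "triple \<Rightarrow> triple" where
  "flip (p, q, r) = (r, q, p)"

fun total :: "triple \<Rightarrow> int" where
  "total (p, q, r) = p + q + r"

section \<open>Correlations of triples and the finite search\<close>

definition lifts :: "int \<Rightarrow> triple list" where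
  "lifts c =
    (if c = 3 then [(1, 1, 1)]
     else if c = 1 then [(1, 1, -1), (1, -1, 1), (-1, 1, 1)]
     else if c = -1 then [(-1, -1, 1), (-1, 1, -1), (1, -1, -1)]
     else [(-1, -1, -1)])"

text \<open>The autocorrelation at shift 1 of the sequence with these six triples, and likewise for
  \<open>cor2\<close>, \<open>cor4\<close>, \<open>cor5\<close>. A pair reaching past the sixth
  triple re-enters at the front with \<open>rot\<close> and a minus sign.\<close>

definition cor1 :: "triple \<Rightarrow> triple \<Rightarrow> triple \<Rightarrow> triple \<Rightarrow> triple \<Rightarrow> triple \<Rightarrow> int" where
  "cor1 t0 t1 t2 t3 t4 t5 =
    dot t0 t1 + dot t1 t2 + dot t2 t3 + dot t3 t4 + dot t4 t5 - dot t5 (rot t0)"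

definition cor2 :: "triple \<Rightarrow> triple \<Rightarrow> triple \<Rightarrow> triple \<Rightarrow> triple \<Rightarrow> triple \<Rightarrow> int" where
  "cor2 t0 t1 t2 t3 t4 t5 =
    dot t0 t2 + dot t1 t3 + dot t2 t4 + dot t3 t5 - dot t4 (rot t0) - dot t5 (rot t1)"

definition cor4 :: "triple \<Rightarrow> triple \<Rightarrow> triple \<Rightarrow> triple \<Rightarrow> triple \<Rightarrow> triple \<Rightarrow> int" where
  "cor4 t0 t1 t2 t3 t4 t5 =
    dot t0 t4 + dot t1 t5 - dot t2 (rot t0) - dot t3 (rot t1) - dot t4 (rot t2) - dot t5 (rot t3)"

definition cor5 :: "triple \<Rightarrow> triple \<Rightarrow> triple \<Rightarrow> triple \<Rightarrow> triple \<Rightarrow> triple \<Rightarrow> int" where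
  "cor5 t0 t1 t2 t3 t4 t5 =
    dot t0 t5 - dot t1 (rot t0) - dot t2 (rot t1) - dot t3 (rot t2) - dot t4 (rot t3) - dot t5 (rot t4)"

definition cor3_part :: "triple \<Rightarrow> triple \<Rightarrow> int" where
  "cor3_part t t' = dot t t' - dot t' (rot t)"

text \<open>Autocorrelation modulo \<open>x^6 + 1\<close>, whence the minus sign at the
  wrap-around.\<close>

definition total_cor1 :: "int \<Rightarrow> int \<Rightarrow> int \<Rightarrow> int \<Rightarrow> int \<Rightarrow> int \<Rightarrow> int" where
  "total_cor1 c0 c1 c2 c3 c4 c5 = c0 * c1 + c1 * c2 + c2 * c3 + c3 * c4 + c4 * c5 - c5 * c0"

definition total_cor2 :: "int \<Rightarrow> int \<Rightarrow> int \<Rightarrow> int \<Rightarrow> int \<Rightarrow> int \<Rightarrow> int" where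
  "total_cor2 c0 c1 c2 c3 c4 c5 = c0 * c2 + c1 * c3 + c2 * c4 + c3 * c5 - c4 * c0 - c5 * c1"

text \<open>
  The search is split into one constant per choice because \<open>code_simp\<close> would otherwise unroll the
  inner loops under the abstractions of the outer ones.  The correlation at shift 3 only pairs
  triples at distance 3, so it is accumulated along the way and prunes most leaves.
\<close>

definition check_leaf where
  "check_leaf n1 n2 n3 n4 n5 t0 t1 t2 t3 t4 t5 =
    (if n3 + cor3_part t2 t5 \<noteq> 0 then True
     else if n1 + cor1 t0 t1 t2 t3 t4 t5 \<noteq> 0 then True
     else if n2 + cor2 t0 t1 t2 t3 t4 t5 \<noteq> 0 then True
     else if n4 + cor4 t0 t1 t2 t3 t4 t5 \<noteq> 0 then True
     else n5 + cor5 t0 t1 t2 t3 t4 t5 \<noteq> 0)"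

definition check_5 where
  "check_5 n1 n2 n3 n4 n5 c5 t0 t1 t3 t4 t2 =
    list_all (check_leaf n1 n2 n3 n4 n5 t0 t1 t2 t3 t4) (lifts c5)"

definition check_2 where
  "check_2 n1 n2 n3 n4 n5 c2 c5 t0 t1 t3 t4 =
    list_all (check_5 n1 n2 (n3 + cor3_part t1 t4) n4 n5 c5 t0 t1 t3 t4) (lifts c2)"

definition check_4 where
  "check_4 n1 n2 n3 n4 n5 c2 c4 c5 t0 t3 t1 =
    list_all (check_2 n1 n2 n3 n4 n5 c2 c5 t0 t1 t3) (lifts c4)"

definition check_1 where
  "check_1 n1 n2 n3 n4 n5 c1 c2 c4 c5 t0 t3 =
    list_all (check_4 n1 n2 (n3 + cor3_part t0 t3) n4 n5 c2 c4 c5 t0 t3) (lifts c1)"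

text \<open>The correlations of the triples of \<open>e\<close> are computed once and handed down as
  \<open>n1\<close> to \<open>n5\<close>. The triple \<open>(1, 1, 1)\<close> is \<open>t0\<close>,
  the only lift of the total 3.\<close>

definition check_even where
  "check_even c1 c2 c3 c4 c5 s0 s1 s2 s3 s4 s5 =
    list_all
      (check_1 (cor1 s0 s1 s2 s3 s4 s5) (cor2 s0 s1 s2 s3 s4 s5)
        (cor3_part s0 s3 + cor3_part s1 s4 + cor3_part s2 s5)
        (cor4 s0 s1 s2 s3 s4 s5) (cor5 s0 s1 s2 s3 s4 s5) c1 c2 c4 c5 (1, 1, 1))
      (lifts c3)"

text \<open>The symmetry of \<open>e\<close> about 9 determines the last two triples from
  \<open>s2\<close> and \<open>s1\<close> and leaves two choices for \<open>s0\<close>.\<close>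

definition check_skew2 where
  "check_skew2 c1 c2 c3 c4 c5 s3 s1 s2 =
    list_all (\<lambda>s0. check_even c1 c2 c3 c4 c5 s0 s1 s2 s3 (flip s2) (flip s1)) [(0, 1, -1), (0, -1, 1)]"

definition check_skew1 where
  "check_skew1 c1 c2 c3 c4 c5 a2 s3 s1 = list_all (check_skew2 c1 c2 c3 c4 c5 s3 s1) (lifts a2)"

text \<open>Truth means that the totals are excluded, since a reduced correlation fails to cancel.
  By symmetry those of \<open>e\<close> are \<open>0, a1, a2, a3, a2, a1\<close>.\<close>

definition check_totals where
  "check_totals a1 a2 a3 c0 c1 c2 c3 c4 c5 \<longleftrightarrow>
    total_cor1 0 a1 a2 a3 a2 a1 + total_cor1 c0 c1 c2 c3 c4 c5 \<noteq> 0 \<or>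
    total_cor2 0 a1 a2 a3 a2 a1 + total_cor2 c0 c1 c2 c3 c4 c5 \<noteq> 0"

text \<open>The list holds the totals of \<open>d\<close> that follow \<open>c0 = 3\<close>. The
  triple of \<open>e\<close> at 3 is \<open>(1, a3 - 2, 1)\<close>, given
  \<open>e 3 = e 15 = 1\<close>. Only totals that survive \<open>check_totals\<close> are lifted to
  signs.\<close>

fun check :: "int \<Rightarrow> int \<Rightarrow> int \<Rightarrow> int list \<Rightarrow> bool" where
  "check a1 a2 a3 [c1, c2, c3, c4, c5] =
    (if check_totals a1 a2 a3 3 c1 c2 c3 c4 c5 then True
     else list_all (check_skew1 c1 c2 c3 c4 c5 a2 (1, a3 - 2, 1)) (lifts a1))"
| "check a1 a2 a3 _ = True"

text \<open>When no total of \<open>d\<close> is \<open>\<plusminus>3\<close>, the reduced correlations alone are contradictory.\<close>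

fun check_small :: "int \<Rightarrow> int \<Rightarrow> int \<Rightarrow> int list \<Rightarrow> bool" where
  "check_small a1 a2 a3 [c0, c1, c2, c3, c4, c5] = check_totals a1 a2 a3 c0 c1 c2 c3 c4 c5"
| "check_small a1 a2 a3 _ = True"

text \<open>\<open>w\<close> counts the entries 3 and -3 among \<open>m\<close> totals. Their
  squares then add up to \<open>m + 8 * w\<close>, so the norm equation ties \<open>w\<close> to the
  totals of \<open>e\<close>.\<close>

fun patterns :: "nat \<Rightarrow> nat \<Rightarrow> int list list" where
  "patterns w 0 = (if w = 0 then [[]] else [])"
| "patterns w (Suc m) =
     map (Cons 1) (patterns w m) @ map (Cons (-1)) (patterns w m) @
     (case w of 0 \<Rightarrow> [] | Suc w' \<Rightarrow>
        map (Cons 3) (patterns w' m) @ map (Cons (-3)) (patterns w' m))"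

lemma in_patterns:
  "set cs \<subseteq> {1, -1, 3, -3} \<Longrightarrow>
    cs \<in> set (patterns (length (filter (\<lambda>c. c * c = 9) cs)) (length cs))"
  by (induction cs) auto

text \<open>The names \<open>check_two\<close>, \<open>check_one\<close>, \<open>check_none\<close>
  give the number of totals 3 and -3 after \<open>c0\<close>. The pairs \<open>(a1, a2)\<close> and
  the values of \<open>a3\<close> are those that \<open>weight_cases\<close> leaves; those of
  \<open>check_small\<close> come from \<open>weight_cases_small\<close>.\<close>

lemma check_two: "list_all (\<lambda>(a1, a2). list_all (check a1 a2 1) (patterns 2 5))
    [(1, 1), (1, -1), (-1, 1), (-1, -1)]"
  by code_simp

lemma check_one: "list_all (\<lambda>(a1, a2). list_all (check a1 a2 3) (patterns 1 5))
    [(1, 1), (1, -1), (-1, 1), (-1, -1)]"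
  by code_simp

lemma check_none: "list_all (\<lambda>(a1, a2). list_all (check a1 a2 1) (patterns 0 5))
    [(3, 1), (3, -1), (-3, 1), (-3, -1), (1, 3), (-1, 3), (1, -3), (-1, -3)]"
  by code_simp

lemma check_small: "list_all (\<lambda>(a1, a2). list_all (check_small a1 a2 3) (patterns 0 6))
    [(3, 1), (3, -1), (-3, 1), (-3, -1), (1, 3), (-1, 3), (1, -3), (-1, -3)]"
  by code_simp

section \<open>Autocorrelations of a negacyclic sequence through its triples\<close>

definition ncor :: "(int \<Rightarrow> int) \<Rightarrow> int \<Rightarrow> int" where
  "ncor f s = (\<Sum>k<18. f (int k - s) * f (int k))"

definition triple_at :: "(int \<Rightarrow> int) \<Rightarrow> int \<Rightarrow> triple" where
  "triple_at f k = (f k, - f (k + 6), f (k + 12))"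

lemma sum_lessThan_18:
  fixes g :: "int \<Rightarrow> int"
  shows "(\<Sum>k<18. g (int k)) = g 0 + g 1 + g 2 + g 3 + g 4 + g 5 + g 6 + g 7 + g 8 + g 9
    + g 10 + g 11 + g 12 + g 13 + g 14 + g 15 + g 16 + g 17"
  by (simp add: eval_nat_numeral lessThan_Suc add_ac)

lemma ncor_18: "ncor f s =
    f (- s) * f 0 + f (1 - s) * f 1 + f (2 - s) * f 2 + f (3 - s) * f 3 + f (4 - s) * f 4
    + f (5 - s) * f 5 + f (6 - s) * f 6 + f (7 - s) * f 7 + f (8 - s) * f 8 + f (9 - s) * f 9
    + f (10 - s) * f 10 + f (11 - s) * f 11 + f (12 - s) * f 12 + f (13 - s) * f 13
    + f (14 - s) * f 14 + f (15 - s) * f 15 + f (16 - s) * f 16 + f (17 - s) * f 17"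
  unfolding ncor_def using sum_lessThan_18[of "\<lambda>k. f (k - s) * f k"] by simp

context
  fixes f :: "int \<Rightarrow> int"
  assumes negacyclic: "\<And>k. f (k + 18) = - f k"
begin

lemma negacyclic_negative:
  "f (-1) = - f 17" "f (-2) = - f 16" "f (-3) = - f 15" "f (-4) = - f 14" "f (-5) = - f 13"
  "f (-6) = - f 12" "f (-7) = - f 11" "f (-8) = - f 10"
  using negacyclic[of "-1"] negacyclic[of "-2"] negacyclic[of "-3"] negacyclic[of "-4"]
    negacyclic[of "-5"] negacyclic[of "-6"] negacyclic[of "-7"] negacyclic[of "-8"] by simp_all

lemmas ncor_expand = ncor_18 triple_at_def negacyclic_negative algebra_simps

lemma ncor_triples:
  "ncor f 1 = cor1 (triple_at f 0) (triple_at f 1) (triple_at f 2) (triple_at f 3) (triple_at f 4) (triple_at f 5)"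
  "ncor f 2 = cor2 (triple_at f 0) (triple_at f 1) (triple_at f 2) (triple_at f 3) (triple_at f 4) (triple_at f 5)"
  "ncor f 3 = cor3_part (triple_at f 0) (triple_at f 3) + cor3_part (triple_at f 1) (triple_at f 4)
    + cor3_part (triple_at f 2) (triple_at f 5)"
  "ncor f 4 = cor4 (triple_at f 0) (triple_at f 1) (triple_at f 2) (triple_at f 3) (triple_at f 4) (triple_at f 5)"
  "ncor f 5 = cor5 (triple_at f 0) (triple_at f 1) (triple_at f 2) (triple_at f 3) (triple_at f 4) (triple_at f 5)"
  by (simp_all add: ncor_expand cor1_def cor2_def cor3_part_def cor4_def cor5_def)

abbreviation "tot k \<equiv> total (triple_at f k)"

text \<open>Modulo \<open>x^6 + 1\<close> the shifts \<open>s\<close>, \<open>s + 6\<close>,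
  \<open>s + 12\<close> combine with alternating signs. The shift \<open>18 - s\<close> has minus
  the correlation of \<open>s\<close>, which brings 12, 13, 14 back to 6, 5, 4.\<close>

lemma ncor_totals:
  "total_cor1 (tot 0) (tot 1) (tot 2) (tot 3) (tot 4) (tot 5) = ncor f 1 - ncor f 7 - ncor f 5"
  "total_cor2 (tot 0) (tot 1) (tot 2) (tot 3) (tot 4) (tot 5) = ncor f 2 - ncor f 8 - ncor f 4"
  "tot 0 * tot 0 + tot 1 * tot 1 + tot 2 * tot 2 + tot 3 * tot 3 + tot 4 * tot 4 + tot 5 * tot 5 =
    ncor f 0 - 2 * ncor f 6"
  by (simp_all add: ncor_expand total_cor1_def total_cor2_def)

text \<open>The summands are 18-periodic, as both factors change sign, so moving the summation
  window changes nothing.\<close>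

lemma ncor_shift: "ncor (\<lambda>j. f (j + int m)) s = ncor f s"
proof (induction m)
  case (Suc m)
  define g where "g k = f (k + int m - s) * f (k + int m)" for k
  have g18: "g 18 = g 0"
    using negacyclic[of "int m - s"] negacyclic[of "int m"] by (simp add: g_def algebra_simps)
  have "ncor (\<lambda>j. f (j + int (Suc m))) s = (\<Sum>k<18. g (int k + 1))"
    unfolding ncor_def g_def by (intro sum.cong) (simp_all add: algebra_simps)
  also have "\<dots> = (\<Sum>k<18. g (int k))"
    using g18 unfolding sum_lessThan_18[of "\<lambda>k. g (k + 1)"] sum_lessThan_18[of g] by simp
  also have "\<dots> = ncor (\<lambda>j. f (j + int m)) s"
    unfolding ncor_def g_def by (intro sum.cong) (simp_all add: algebra_simps)
  finally show ?case using Suc by simp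
qed simp

end

section \<open>Soundness of the search and the possible weights\<close>

lemma lifts_total:
  "p \<in> {1, -1} \<Longrightarrow> q \<in> {1, -1} \<Longrightarrow> r \<in> {1, -1} \<Longrightarrow> (p, - q, r) \<in> set (lifts (p - q + r))"
  by (auto simp: lifts_def)

text \<open>The triples of an actual pair pass through every loop of the search and arrive at
  \<open>check_leaf\<close>, which demands a nonzero correlation.\<close>

lemma check_sound:
  assumes chk: "check a1 a2 a3 [c1, c2, c3, c4, c5]"
    and totals: "\<not> check_totals a1 a2 a3 3 c1 c2 c3 c4 c5"
    and s: "s0 \<in> {(0, 1, -1), (0, -1, 1)}" "s1 \<in> set (lifts a1)" "s2 \<in> set (lifts a2)"
      "s3 = (1, a3 - 2, 1)" "s4 = flip s2" "s5 = flip s1"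
    and t: "t0 = (1, 1, 1)" "t1 \<in> set (lifts c1)" "t2 \<in> set (lifts c2)" "t3 \<in> set (lifts c3)"
      "t4 \<in> set (lifts c4)" "t5 \<in> set (lifts c5)"
    and cor: "cor1 s0 s1 s2 s3 s4 s5 + cor1 t0 t1 t2 t3 t4 t5 = 0"
      "cor2 s0 s1 s2 s3 s4 s5 + cor2 t0 t1 t2 t3 t4 t5 = 0"
      "(cor3_part s0 s3 + cor3_part s1 s4 + cor3_part s2 s5) +
        (cor3_part t0 t3 + cor3_part t1 t4 + cor3_part t2 t5) = 0"
      "cor4 s0 s1 s2 s3 s4 s5 + cor4 t0 t1 t2 t3 t4 t5 = 0"
      "cor5 s0 s1 s2 s3 s4 s5 + cor5 t0 t1 t2 t3 t4 t5 = 0"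
  shows False
proof -
  have "check_skew1 c1 c2 c3 c4 c5 a2 s3 s1"
    using chk totals s by (simp add: list_all_iff)
  then have "check_skew2 c1 c2 c3 c4 c5 s3 s1 s2"
    using s by (simp add: check_skew1_def list_all_iff)
  then have "check_even c1 c2 c3 c4 c5 s0 s1 s2 s3 s4 s5"
    using s by (auto simp: check_skew2_def)
  then have "check_1 (cor1 s0 s1 s2 s3 s4 s5) (cor2 s0 s1 s2 s3 s4 s5)
        (cor3_part s0 s3 + cor3_part s1 s4 + cor3_part s2 s5)
        (cor4 s0 s1 s2 s3 s4 s5) (cor5 s0 s1 s2 s3 s4 s5) c1 c2 c4 c5 t0 t3" (is "check_1 ?n1 ?n2 ?n3 ?n4 ?n5 _ _ _ _ _ _")
    using t by (simp add: check_even_def list_all_iff)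
  \<comment> \<open>The triples are chosen in the order \<open>t1\<close>, \<open>t4\<close>,
    \<open>t2\<close>, \<open>t5\<close>; each pair at distance 3 enters the third sum once it is
    complete.\<close>
  then have "check_4 ?n1 ?n2 (?n3 + cor3_part t0 t3) ?n4 ?n5 c2 c4 c5 t0 t3 t1"
    using t(2) unfolding check_1_def list_all_iff by (rule bspec)
  then have "check_2 ?n1 ?n2 (?n3 + cor3_part t0 t3) ?n4 ?n5 c2 c5 t0 t1 t3 t4"
    using t(5) unfolding check_4_def list_all_iff by (rule bspec)
  then have "check_5 ?n1 ?n2 (?n3 + cor3_part t0 t3 + cor3_part t1 t4) ?n4 ?n5 c5 t0 t1 t3 t4 t2"
    using t(3) unfolding check_2_def list_all_iff by (rule bspec)
  then have "check_leaf ?n1 ?n2 (?n3 + cor3_part t0 t3 + cor3_part t1 t4) ?n4 ?n5 t0 t1 t2 t3 t4 t5"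
    using t(6) unfolding check_5_def list_all_iff by (rule bspec)
  then show False
    using cor unfolding check_leaf_def by (simp only: add.assoc if_False not_True_eq_False simp_thms)
qed

lemma sum_list_squares:
  fixes cs :: "int list"
  shows "set cs \<subseteq> {1, -1, 3, -3} \<Longrightarrow>
    (\<Sum>c\<leftarrow>cs. c * c) = int (length cs) + 8 * int (length (filter (\<lambda>c. c * c = 9) cs))"
  by (induction cs) auto

lemma list_all_pairsD:
  "list_all (\<lambda>(x, y). list_all (P x y) zs) xys \<Longrightarrow> (x, y) \<in> set xys \<Longrightarrow> z \<in> set zs \<Longrightarrow> P x y z"
  by (auto simp: list_all_iff)

lemmas check_patterns =
  list_all_pairsD[OF check_two, unfolded list.set]
  list_all_pairsD[OF check_one, unfolded list.set]
  list_all_pairsD[OF check_none, unfolded list.set]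
  list_all_pairsD[OF check_small, unfolded list.set]

text \<open>The value 21 is the norm 35 without the square 9 of \<open>c 0\<close> and without a 1
  for each of the five other totals of \<open>d\<close>.\<close>

lemma weight_cases:
  fixes a1 a2 a3 :: int and w :: nat
  assumes "a1 \<in> {1, -1, 3, -3}" "a2 \<in> {1, -1, 3, -3}" "a3 \<in> {1, 3}"
    and "2 * (a1 * a1) + 2 * (a2 * a2) + a3 * a3 + 8 * int w = 21"
  shows "w = 2 \<and> a3 = 1 \<and> (a1, a2) \<in> {(1, 1), (1, -1), (-1, 1), (-1, -1)} \<or>
    w = 1 \<and> a3 = 3 \<and> (a1, a2) \<in> {(1, 1), (1, -1), (-1, 1), (-1, -1)} \<or>
    w = 0 \<and> a3 = 1 \<and> (a1, a2) \<in>
      {(3, 1), (3, -1), (-3, 1), (-3, -1), (1, 3), (-1, 3), (1, -3), (-1, -3)}"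
proof -
  \<comment> \<open>The squares are at least 1, so \<open>5 + 8 * int w\<close> is at most 21, which
    bounds \<open>w\<close> by 2.\<close>
  have "x * x \<ge> 1" if "x \<in> {1, -1, 3, -3}" for x :: int using that by auto
  from this[OF assms(1)] this[OF assms(2)] this[of a3] assms(3,4) have "w \<le> 2" by auto
  then have "w \<in> {0, 1, 2}" by auto
  with assms show ?thesis by (elim insertE emptyE) simp_all
qed

text \<open>Here six squares equal to 1 are removed from 35.\<close>

lemma weight_cases_small:
  fixes a1 a2 a3 :: int
  assumes "a1 \<in> {1, -1, 3, -3}" "a2 \<in> {1, -1, 3, -3}" "a3 \<in> {1, 3}"
    and "2 * (a1 * a1) + 2 * (a2 * a2) + a3 * a3 = 29"
  shows "a3 = 3 \<and> (a1, a2) \<in>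
      {(3, 1), (3, -1), (-3, 1), (-3, -1), (1, 3), (-1, 3), (1, -3), (-1, -3)}"
  using assms by (elim insertE emptyE) simp_all

section \<open>A normalised pair of sign sequences\<close>

locale sign_pair =
  fixes e d :: "int \<Rightarrow> int"
  assumes e_negacyclic: "e (k + 18) = - e k" and e_odd: "e (- k) = - e k"
    and e_sign: "\<not> 18 dvd k \<Longrightarrow> e k \<in> {1, -1}"
    and d_negacyclic: "d (k + 18) = - d k" and d_sign: "d k \<in> {1, -1}"
    and correlation: "0 < s \<Longrightarrow> s < 18 \<Longrightarrow> ncor e s + ncor d s = 0"
    and e_3: "e 3 = 1"
begin

lemma e_0: "e 0 = 0" using e_odd[of 0] by simp

text \<open>The signs from oddness and from the shift by 18 cancel.\<close>

lemma e_symmetric: "e (18 - k) = e k"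
  using e_negacyclic[of "- k"] e_odd[of k] by (simp add: algebra_simps)

lemma e_values: "e 10 = e 8" "e 11 = e 7" "e 12 = e 6" "e 13 = e 5" "e 14 = e 4" "e 15 = e 3"
    "e 16 = e 2" "e 17 = e 1"
  using e_symmetric[of 8] e_symmetric[of 7] e_symmetric[of 6] e_symmetric[of 5]
    e_symmetric[of 4] e_symmetric[of 3] e_symmetric[of 2] e_symmetric[of 1] by simp_all

abbreviation "a k \<equiv> total (triple_at e k)"
abbreviation "c k \<equiv> total (triple_at d k)"

text \<open>Reflection about 9 reverses each triple and exchanges those at \<open>k\<close> and
  \<open>6 - k\<close>. The triple at 3 is therefore a palindrome, and in the one at 0 the values
  \<open>e 6 = e 12\<close> enter with opposite signs.\<close>

lemma triple_e: "triple_at e 0 \<in> {(0, 1, -1), (0, -1, 1)}" "triple_at e 3 = (1, a 3 - 2, 1)"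
    "triple_at e 4 = flip (triple_at e 2)" "triple_at e 5 = flip (triple_at e 1)"
    "triple_at e 1 \<in> set (lifts (a 1))" "triple_at e 2 \<in> set (lifts (a 2))"
proof -
  show "triple_at e 0 \<in> {(0, 1, -1), (0, -1, 1)}"
    using e_sign[of 6] by (auto simp: triple_at_def e_0 e_values)
  show "triple_at e 1 \<in> set (lifts (a 1))"
    using lifts_total[of "e 1" "e 7" "e 5"] e_sign[of 1] e_sign[of 7] e_sign[of 5]
    by (simp add: triple_at_def e_values)
  show "triple_at e 2 \<in> set (lifts (a 2))"
    using lifts_total[of "e 2" "e 8" "e 4"] e_sign[of 2] e_sign[of 8] e_sign[of 4]
    by (simp add: triple_at_def e_values)
qed (simp_all add: triple_at_def e_values e_3)

lemma triple_d: "triple_at d k \<in> set (lifts (c k))"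
  using d_sign[of k] d_sign[of "k + 6"] d_sign[of "k + 12"]
    lifts_total[of "d k" "d (k + 6)" "d (k + 12)"]
  by (auto simp: triple_at_def)

lemma a_values: "a 0 = 0" "a 4 = a 2" "a 5 = a 1" "a 1 \<in> {1, -1, 3, -3}" "a 2 \<in> {1, -1, 3, -3}" "a 3 \<in> {1, 3}"
  using e_sign[of 1] e_sign[of 7] e_sign[of 5] e_sign[of 2] e_sign[of 8] e_sign[of 4] e_sign[of 9]
  by (auto simp: triple_at_def e_0 e_values e_3)

lemma c_values: "c k \<in> {1, -1, 3, -3}"
  using d_sign[of k] d_sign[of "k + 6"] d_sign[of "k + 12"] by (auto simp: triple_at_def)

lemma ncor_0: "ncor e 0 = 17" "ncor d 0 = 18"
proof -
  have "e k * e k = 1" if "\<not> 18 dvd k" for k using e_sign[OF that] by auto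
  then show "ncor e 0 = 17"
    unfolding ncor_18 by (simp add: e_0)
  have "d k * d k = 1" for k using d_sign[of k] by auto
  then show "ncor d 0 = 18" by (simp add: ncor_def)
qed

text \<open>The shifts 1, 5, 7 and 2, 4, 8 that enter \<open>ncor_totals\<close> all cancel between
  \<open>e\<close> and \<open>d\<close>.\<close>

lemma not_check_totals: "\<not> check_totals (a 1) (a 2) (a 3) (c 0) (c 1) (c 2) (c 3) (c 4) (c 5)"
  using ncor_totals(1,2)[of e, OF e_negacyclic] ncor_totals(1,2)[of d, OF d_negacyclic]
    correlation[of 1] correlation[of 2] correlation[of 4] correlation[of 5] correlation[of 7] correlation[of 8]
  by (simp add: check_totals_def a_values)

text \<open>Shift 0 gives 17 + 18, and the correction at shift 6 cancels between \<open>e\<close>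
  and \<open>d\<close>.\<close>

lemma norm_totals: "2 * (a 1 * a 1) + 2 * (a 2 * a 2) + a 3 * a 3 + (c 0 * c 0 + c 1 * c 1 + c 2 * c 2
    + c 3 * c 3 + c 4 * c 4 + c 5 * c 5) = 35"
  using ncor_totals(3)[of e, OF e_negacyclic] ncor_totals(3)[of d, OF d_negacyclic]
    correlation[of 6] ncor_0 by (simp add: a_values)

text \<open>The norm equation limits the number of further totals 3 and -3, and each remaining case
  is one of the evaluated checks.\<close>

lemma check_pattern:
  assumes c: "c 0 = 3"
  shows "check (a 1) (a 2) (a 3) [c 1, c 2, c 3, c 4, c 5]"
proof -
  define cs where "cs = [c 1, c 2, c 3, c 4, c 5]"
  define w where "w = length (filter (\<lambda>c. c * c = 9) cs)"
  have cs: "set cs \<subseteq> {1, -1, 3, -3}" "length cs = 5" using c_values by (simp_all add: cs_def)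
  have pat: "cs \<in> set (patterns w 5)"
    using in_patterns[OF cs(1)] unfolding w_def cs(2) .
  have "(\<Sum>x\<leftarrow>cs. x * x) = c 1 * c 1 + c 2 * c 2 + c 3 * c 3 + c 4 * c 4 + c 5 * c 5"
    by (simp add: cs_def)
  then have w: "c 1 * c 1 + c 2 * c 2 + c 3 * c 3 + c 4 * c 4 + c 5 * c 5 = 5 + 8 * int w"
    using sum_list_squares[OF cs(1)] unfolding cs(2) w_def[symmetric] by simp
  have eq: "2 * (a 1 * a 1) + 2 * (a 2 * a 2) + a 3 * a 3 + 8 * int w = 21"
    using norm_totals w c by simp
  from weight_cases[OF a_values(4-6) eq] show ?thesis
    unfolding cs_def[symmetric]
    by (elim disjE conjE; use pat check_patterns(1-3)[of "a 1" "a 2" cs] in \<open>simp only:\<close>)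
qed

text \<open>By \<open>c_large\<close>, a shift and a change of sign of \<open>d\<close> would achieve \<open>c 0 = 3\<close>.\<close>

lemma c_0_not_3: "c 0 \<noteq> 3"
proof
  assume c: "c 0 = 3"
  have t0: "triple_at d 0 = (1, 1, 1)"
    using triple_d[of 0] unfolding c by (simp add: lifts_def)
  note e_cor = ncor_triples[of e, OF e_negacyclic] and d_cor = ncor_triples[of d, OF d_negacyclic]
  have cor: "ncor e 1 + ncor d 1 = 0" "ncor e 2 + ncor d 2 = 0" "ncor e 3 + ncor d 3 = 0"
    "ncor e 4 + ncor d 4 = 0" "ncor e 5 + ncor d 5 = 0"
    by (rule correlation; simp)+
  show False
    by (rule check_sound[OF check_pattern[OF c] not_check_totals[unfolded c] triple_e(1,5,6,2,3,4)
          t0 triple_d triple_d triple_d triple_d triple_d cor[unfolded e_cor d_cor]])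
qed

text \<open>Otherwise the six squares of \<open>d\<close> add up to 6, leaving 29 for
  \<open>e\<close>, and \<open>check_small\<close> excludes all such totals.\<close>

lemma c_large: "\<exists>k\<in>{0, 1, 2, 3, 4, 5}. c k \<in> {3, -3}"
proof (rule ccontr)
  assume "\<not> ?thesis"
  then have c: "c k \<in> {1, -1}" if "k \<in> {0, 1, 2, 3, 4, 5}" for k
    using c_values[of k] that by auto
  define cs where "cs = [c 0, c 1, c 2, c 3, c 4, c 5]"
  have one: "c k * c k = 1" if "k \<in> {0, 1, 2, 3, 4, 5}" for k using c[OF that] by auto
  have "set cs \<subseteq> {1, -1, 3, -3}" using c_values by (simp add: cs_def)
  moreover have "filter (\<lambda>c. c * c = 9) cs = []"
    using one[of 0] one[of 1] one[of 2] one[of 3] one[of 4] one[of 5] by (simp add: cs_def)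
  moreover have "length cs = 6" by (simp add: cs_def)
  ultimately have pat: "cs \<in> set (patterns 0 6)"
    using in_patterns[of cs] by (simp only: list.size)
  have eq: "2 * (a 1 * a 1) + 2 * (a 2 * a 2) + a 3 * a 3 = 29"
    using norm_totals by (simp add: one)
  have "check_small (a 1) (a 2) (a 3) cs"
    using weight_cases_small[OF a_values(4-6) eq] pat check_patterns(4)[of "a 1" "a 2" cs]
    by (elim conjE) (simp only:)
  then show False using not_check_totals by (simp add: cs_def)
qed

end

section \<open>Normalisation of the signs and conclusion\<close>

lemma sign_pair_impossible:
  assumes "sign_pair e d"
  shows False
proof -
  interpret sign_pair e d by fact
  obtain k where k: "k \<in> {0, 1, 2, 3, 4, 5}" "c k \<in> {3, -3}" using c_large by blast
  define m where "m = nat k"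
  have km: "k = int m" using k by (auto simp: m_def)
  \<comment> \<open>Shifting \<open>d\<close> by \<open>k\<close> and multiplying by the sign
    \<open>d k\<close> moves the large total to index 0 and makes it 3, without changing the
    correlations.\<close>
  define s where "s = d k"
  have s: "s * s = 1" "s \<in> {1, -1}" using d_sign[of k] by (auto simp: s_def)
  define d' where "d' j = s * d (j + int m)" for j
  have "sign_pair e d'"
  proof
    show "d' (j + 18) = - d' j" for j
      using d_negacyclic[of "j + int m"] by (simp add: d'_def algebra_simps)
    show "d' j \<in> {1, -1}" for j using s d_sign[of "j + int m"] by (auto simp: d'_def)
    show "ncor e t + ncor d' t = 0" if "0 < t" "t < 18" for t
    proof -
      have "ncor d' t = (s * s) * ncor (\<lambda>j. d (j + int m)) t"
        unfolding ncor_def d'_def by (simp add: sum_distrib_left mult_ac)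
      then show ?thesis
        using ncor_shift[of d m t, OF d_negacyclic] s correlation[OF that] by simp
    qed
  qed (fact e_negacyclic e_odd e_3 | (rule e_sign, assumption))+
  moreover have "total (triple_at d' 0) = s * c k"
    by (simp add: triple_at_def d'_def km algebra_simps)
  \<comment> \<open>A total of 3 or -3 forces its three signed summands to agree, and the first of
    them is \<open>d k\<close>.\<close>
  moreover have "s * c k = 3"
    using k(2) d_sign[of k] d_sign[of "k + 6"] d_sign[of "k + 12"] unfolding s_def triple_at_def
    by (elim insertE emptyE) simp_all
  ultimately show False using sign_pair.c_0_not_3[of e d'] by simp
qed

lemma dihedral_frame_18_impossible:
  assumes "dihedral_frame 18 U T v \<gamma> A c"
  shows False
proof -
  interpret F: dihedral_frame 18 U T v \<gamma> A c by fact
  \<comment> \<open>Correlations do not see a global sign of \<open>e\<close>, so \<open>e\<close>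
    may be multiplied by its own value at 3 to make that value 1.\<close>
  define s where "s = F.e 3"
  have s: "s * s = 1" "s \<in> {1, -1}" using F.e_sign[of 3] by (auto simp: s_def)
  have "sign_pair (\<lambda>k. s * F.e k) F.d"
  proof
    show "s * F.e (k + 18) = - (s * F.e k)" for k using F.e_add_n[of k] by simp
    show "s * F.e (- k) = - (s * F.e k)" for k using F.e_minus[of k] by simp
    show "s * F.e k \<in> {1, -1}" if "\<not> 18 dvd k" for k using F.e_sign[of k] that s(2) by auto
    show "F.d (k + 18) = - F.d k" for k using F.d_add_n[of k] by simp
    show "F.d k \<in> {1, -1}" for k by (rule F.d_sign)
    show "ncor (\<lambda>k. s * F.e k) t + ncor F.d t = 0" if "0 < t" "t < 18" for t
    proof -
      have "ncor (\<lambda>k. s * F.e k) t = (s * s) * ncor F.e t"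
        unfolding ncor_def by (simp add: sum_distrib_left mult_ac)
      then show ?thesis
        using F.sign_correlation[of t] that s(1) by (simp add: ncor_def sum.distrib)
    qed
    show "s * F.e 3 = 1" using s(1) by (simp add: s_def)
  qed
  then show False by (rule sign_pair_impossible)
qed

theorem theorem6p1:
  shows "\<not> (\<exists>\<phi>. regular_dihedral_configuration 18 \<phi> \<and> ETF 36 18 (carrier (dihedral 18)) \<phi>)"
proof
  assume "\<exists>\<phi>. regular_dihedral_configuration 18 \<phi> \<and> ETF 36 18 (carrier (dihedral 18)) \<phi>"
  then obtain \<phi> where conf: "regular_dihedral_configuration 18 \<phi>"
    and etf: "ETF (2 * 18) 18 (carrier (dihedral 18)) \<phi>" by auto
  obtain U T v \<gamma> A c where "dihedral_frame 18 U T v \<gamma> A c"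
    using dihedral_frame_exists[OF _ _ conf etf] by auto
  then show False by (rule dihedral_frame_18_impossible)
qed

end
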